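(* Let $f:\mathbb R^m\to\mathbb R$ be convex and $C^2$ with an attained minimum $f^\star$, $F=f-f^\star$, and let $\mathcal B$ be a partition of the $m$ coordinates with finite constants $\kappa_B,\nu_B\ge0$ $(B\in\mathcal B)$ such that $0\preceq\nabla^2_{BB}f(u)\preceq(\kappa_B+\nu_BF(u))I_B$ for every $u\in\mathbb R^m$ and every $B\in\mathcal B$. Put $C_0=\sum_B\sqrt{\kappa_B}$, $C_1=\sum_B\sqrt{\nu_B}$ and assume $C_0>0$. Let the inputs of the accelerated block coordinate algorithm described in the context satisfy $\bar\Delta\ge F(z)$, $r\ge\|z-u^\star\|_2$ for some minimizer $u^\star$ of $f$, $\delta\in(0,1)$ and $0<\varepsilon<\bar\Delta$. Let $N$ be the first index with $T_N\ge\Pi/\varepsilon$. Then $$\mathbb P\bigl(F(u_N)\le\varepsilon\bigr)\ge1-\delta$$ and $$N=\widetilde O\!\left(1+\frac{rC_0}{\sqrt{\delta\varepsilon}}+\frac{rC_1}{\sqrt\delta}\right).$$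
   Context: Notation: $U_B:\mathbb R^{|B|}\to\mathbb R^m$ is the zero-padding injection for block $B$, $\nabla_Bf$ the block gradient. $\widetilde O$ suppresses absolute constants and factors logarithmic in the problem parameters ($r,C_0,C_1,\bar\Delta,\delta,\varepsilon$). Fixed distributions on blocks: $\pi^{(0)}_B=\sqrt{\kappa_B}/C_0$ and, if $C_1>0$, $\pi^{(1)}_B=\sqrt{\nu_B}/C_1$ (a block with $\kappa_B=\nu_B=0$ is never drawn). Algorithm. Inputs: anchor $z\in\mathbb R^m$, gap bound $\bar\Delta$, radius $r$, failure level $\delta$, target $\varepsilon$. (1) If $C_0=0$, $r=0$, $\bar\Delta=0$ or $\varepsilon\ge\bar\Delta$, return $z$. (2) Set $T_0=r^2/(2\bar\Delta)$, $u_0=v_0=z$, $\Pi=r^2/\delta$. (3) For $k=0,1,\dots$: set $\Delta_k=\Pi/T_k$ and $M_k=C_0+\sqrt{5\Delta_k}\,C_1$; choose $a_{k+1}>0$ with $M_k^2a_{k+1}^2=T_k+a_{k+1}$ and set $T_{k+1}=T_k+a_{k+1}$; set $y_k=(T_ku_k+a_{k+1}v_k)/T_{k+1}$; with probability $C_0/M_k$ draw $B_k\sim\pi^{(0)}$, otherwise draw $B_k\sim\pi^{(1)}$ (fresh randomness, conditionally on the past); set $\sqrt{\bar L_{k,B_k}}=\sqrt{\kappa_{B_k}}+\sqrt{5\nu_{B_k}\Delta_k}$ and $p_{k,B_k}=\sqrt{\bar L_{k,B_k}}/M_k$; set $g=\nabla_{B_k}f(y_k)$; pick any $u_{k+1}\in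 y_k+\operatorname{range}U_{B_k}$ with $f(u_{k+1})\le f(y_k-U_{B_k}g/\bar L_{k,B_k})$; set $v_{k+1}=v_k-(a_{k+1}/p_{k,B_k})U_{B_k}g$; if $T_{k+1}\ge\Pi/\varepsilon$, return $u_{k+1}$. The sequence $T_k$ is deterministic, so $N$ is deterministic; in the case $r=0$ the output is $u_N=z$ with $N=0$. *)

theory Defs
  imports "HOL-Analysis.Analysis" "HOL-Probability.Probability"
begin

definition gradient :: "(real^'m \<Rightarrow> real) \<Rightarrow> real^'m \<Rightarrow> real^'m" where
  "gradient f x = (\<chi> i. frechet_derivative f (at x) (axis i 1))"

definition hessian :: "(real^'m \<Rightarrow> real) \<Rightarrow> real^'m \<Rightarrow> real^'m^'m" where
  "hessian f x = jacobian (gradient f) (at x)"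

definition C2_function :: "(real^'m \<Rightarrow> real) \<Rightarrow> bool" where
  "C2_function f \<longleftrightarrow>
     (\<forall>x. f differentiable (at x)) \<and>
     (\<forall>x. gradient f differentiable (at x)) \<and>
     continuous_on UNIV (hessian f)"

(* The space R^B of a block B of coordinates is identified with its image under the zero-padding
   injection U_B, that is, with the vectors supported on B. Vectors and B x B matrices
   are therefore represented by their zero-paddings. *)

definition block_range :: "'m set \<Rightarrow> (real^'m) set" where
  "block_range B = {x. \<forall>i. i \<notin> B \<longrightarrow> x $ i = 0}"

definition block_gradient :: "'m set \<Rightarrow> (real^'m \<Rightarrow> real) \<Rightarrow> real^'m \<Rightarrow> real^'m" where
  "block_gradient B f x = (\<chi> i. if i \<in> B then gradient f x $ i else 0)"

definition block_hessian :: "'m set \<Rightarrow> (real^'m \<Rightarrow> real) \<Rightarrow> real^'m \<Rightarrow> real^'m^'m" where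
  "block_hessian B f x = (\<chi> i j. if i \<in> B \<and> j \<in> B then hessian f x $ i $ j else 0)"

definition block_identity :: "'m set \<Rightarrow> real^'m^'m" where
  "block_identity B = (\<chi> i j. if i = j \<and> i \<in> B then 1 else 0)"

(* Loewner order. It is only applied to symmetric matrices: the Hessian of a C2 function is
   symmetric. On matrices padded from B x B it agrees with the order of the B x B matrices. *)
definition loewner_le :: "real^'m^'m \<Rightarrow> real^'m^'m \<Rightarrow> bool" where
  "loewner_le A B \<longleftrightarrow> (\<forall>x. x \<bullet> (A *v x) \<le> x \<bullet> (B *v x))"

(* Pi = r^2 / delta *)
definition budget :: "real \<Rightarrow> real \<Rightarrow> real" where
  "budget r \<delta> = r\<^sup>2 / \<delta>"

(* M_k as a function of Delta_k *)
definition rate :: "real \<Rightarrow> real \<Rightarrow> real \<Rightarrow> real" where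
  "rate C0 C1 \<Delta> = C0 + sqrt (5 * \<Delta>) * C1"

(* For M > 0 and T >= 0 the equation has exactly one positive solution a. *)
definition step_weight :: "real \<Rightarrow> real \<Rightarrow> real" where
  "step_weight M T = (THE a. a > 0 \<and> M\<^sup>2 * a\<^sup>2 = T + a)"

primrec T_seq :: "real \<Rightarrow> real \<Rightarrow> real \<Rightarrow> real \<Rightarrow> real \<Rightarrow> nat \<Rightarrow> real" where
  "T_seq C0 C1 \<Delta>bar r \<delta> 0 = r\<^sup>2 / (2 * \<Delta>bar)"
| "T_seq C0 C1 \<Delta>bar r \<delta> (Suc k) =
     (let T = T_seq C0 C1 \<Delta>bar r \<delta> k
      in T + step_weight (rate C0 C1 (budget r \<delta> / T)) T)"

(* First index N with T_N >= Pi / eps. For r > 0, 0 < delta < 1 and 0 < eps < Delta_bar one has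
   T_0 < Pi / eps, so testing T_0 as well does not differ from testing after each step;
   for r = 0 the value is 0, in agreement with the immediate return of the anchor. *)
definition stop_index :: "real \<Rightarrow> real \<Rightarrow> real \<Rightarrow> real \<Rightarrow> real \<Rightarrow> real \<Rightarrow> nat" where
  "stop_index C0 C1 \<Delta>bar r \<delta> \<epsilon> = (LEAST k. T_seq C0 C1 \<Delta>bar r \<delta> k \<ge> budget r \<delta> / \<epsilon>)"

(* With weights kappa this is pi^(0), with weights nu it is pi^(1). If all weights vanish the
   value is unspecified; block_law then selects it with probability 0. *)
definition block_dist :: "'m set set \<Rightarrow> ('m set \<Rightarrow> real) \<Rightarrow> 'm set pmf" where
  "block_dist \<B> w =
     embed_pmf (\<lambda>B. if B \<in> \<B> then sqrt (w B) / (\<Sum>B'\<in>\<B>. sqrt (w B')) else 0)"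

definition block_law ::
  "'m set set \<Rightarrow> ('m set \<Rightarrow> real) \<Rightarrow> ('m set \<Rightarrow> real) \<Rightarrow> real \<Rightarrow> real \<Rightarrow> 'm set pmf" where
  "block_law \<B> \<kappa> \<nu> C0 M =
     bernoulli_pmf (C0 / M) \<bind> (\<lambda>b. if b then block_dist \<B> \<kappa> else block_dist \<B> \<nu>)"

(* Passage from (u, v) = (u_k, v_k) to (u', v') = (u_{k+1}, v_{k+1}) when the block B is drawn;
   T = T_k, Delta = Delta_k, M = M_k. Any admissible u' is allowed. *)
definition accel_step ::
  "(real^'m \<Rightarrow> real) \<Rightarrow> ('m set \<Rightarrow> real) \<Rightarrow> ('m set \<Rightarrow> real) \<Rightarrow> real \<Rightarrow> real \<Rightarrow> real \<Rightarrow>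
   'm set \<Rightarrow> real^'m \<Rightarrow> real^'m \<Rightarrow> real^'m \<Rightarrow> real^'m \<Rightarrow> bool" where
  "accel_step f \<kappa> \<nu> M \<Delta> T B u v u' v' \<longleftrightarrow>
     (let a = step_weight M T;
          y = (1 / (T + a)) *\<^sub>R (T *\<^sub>R u + a *\<^sub>R v);
          sqrtL = sqrt (\<kappa> B) + sqrt (5 * \<nu> B * \<Delta>);
          p = sqrtL / M;
          g = block_gradient B f y
      in u' - y \<in> block_range B \<and>
         f u' \<le> f (y - (1 / sqrtL\<^sup>2) *\<^sub>R g) \<and>
         v' = v - (a / p) *\<^sub>R g)"

(* A run of the algorithm on the probability space P, up to the stopping index. The sigma-algebra
   Fil k is the information available before B_k is drawn; it may contain more than the
   past of (u, v, B), so that u_{k+1} may be chosen by any adapted, possibly randomized, rule. *)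
definition accel_run ::
  "'w measure \<Rightarrow> (nat \<Rightarrow> 'w measure) \<Rightarrow> (real^'m \<Rightarrow> real) \<Rightarrow> 'm set set \<Rightarrow>
   ('m set \<Rightarrow> real) \<Rightarrow> ('m set \<Rightarrow> real) \<Rightarrow> real^'m \<Rightarrow> real \<Rightarrow> real \<Rightarrow> real \<Rightarrow> real \<Rightarrow>
   (nat \<Rightarrow> 'w \<Rightarrow> real^'m) \<Rightarrow> (nat \<Rightarrow> 'w \<Rightarrow> real^'m) \<Rightarrow> (nat \<Rightarrow> 'w \<Rightarrow> 'm set) \<Rightarrow> bool" where
  "accel_run P Fil f \<B> \<kappa> \<nu> z \<Delta>bar r \<delta> \<epsilon> u v Blk \<longleftrightarrow>
     (let C0 = (\<Sum>B\<in>\<B>. sqrt (\<kappa> B));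
          C1 = (\<Sum>B\<in>\<B>. sqrt (\<nu> B));
          N = stop_index C0 C1 \<Delta>bar r \<delta> \<epsilon>;
          T = T_seq C0 C1 \<Delta>bar r \<delta>;
          \<Delta> = (\<lambda>k. budget r \<delta> / T k);
          M = (\<lambda>k. rate C0 C1 (\<Delta> k))
      in filtration (space P) Fil \<and> (\<forall>k. subalgebra P (Fil k)) \<and>
         (\<forall>k\<le>N. u k \<in> borel_measurable (Fil k) \<and> v k \<in> borel_measurable (Fil k)) \<and>
         (\<forall>k<N. Blk k \<in> measurable (Fil (Suc k)) (count_space UNIV)) \<and>
         (\<forall>\<omega>\<in>space P. u 0 \<omega> = z \<and> v 0 \<omega> = z) \<and>
         (\<forall>k<N. \<forall>B. AE \<omega> in P.
            real_cond_exp P (Fil k) (indicator {\<omega> \<in> space P. Blk k \<omega> = B}) \<omega>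
              = pmf (block_law \<B> \<kappa> \<nu> C0 (M k)) B) \<and>
         (\<forall>k<N. AE \<omega> in P.
            accel_step f \<kappa> \<nu> (M k) (\<Delta> k) (T k) (Blk k \<omega>)
              (u k \<omega>) (v k \<omega>) (u (Suc k) \<omega>) (v (Suc k) \<omega>)))"

(* The soft-O notation suppresses powers of this factor. Note that ln 0 = 0, so a vanishing
   parameter contributes nothing. *)
definition log_factor :: "real list \<Rightarrow> real" where
  "log_factor ps = 1 + (\<Sum>x\<leftarrow>ps. \<bar>ln x\<bar>)"

end

theory Submission
  imports Defs
begin

text \<open>
  Write \<open>F = f - fstar\<close>, \<open>a\<close> for the step weight and \<open>T' = T + a\<close>. The proof follows the potential
  \<open>T * F(u) + |v - ustar|^2 / 2\<close> of accelerated gradient descent. It starts at most at \<open>r^2\<close>, and, as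
  long as it has not exceeded \<open>\<Pi> = r^2 / \<delta>\<close>, it does not grow in conditional expectation. The
  bound of Ville for nonnegative supermartingales then shows that it exceeds \<open>\<Pi>\<close> before
  or at the stopping index with probability at most \<open>\<delta>\<close>; when it does not, \<open>F(u_N) \<le> \<Pi> / T_N \<le> \<epsilon>\<close>.

  The curvature bounds depend on the value of \<open>F\<close>, so they are useful only where \<open>F\<close> is known to
  be at most \<open>5 \<Delta>\<close>, where \<open>\<Delta> = \<Pi> / T\<close>. This is where the bound \<open>\<Pi>\<close> on the potential enters. The point \<open>v\<close>
  itself may have a large value, but the coupling point \<open>y\<close> differs from a convex combination of
  \<open>u\<close> and \<open>ustar\<close>, where \<open>F\<close> is at most \<open>\<Pi> / T'\<close>, by \<open>(a / T') (v - ustar)\<close>, a vector of length at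
  most \<open>sqrt (2 \<Pi> / T') / M\<close>. Since the full Hessian is at most \<open>M^2\<close> on \<open>{F \<le> 5 \<Delta>}\<close>
  (lemma \<open>full_curvature\<close>), a continuity argument along this segment gives \<open>F(y) \<le> 4 \<Pi> / T'\<close>
  (\<open>coupling_point_gap\<close>). A gradient step in one block never leaves the sublevel
  set of \<open>y\<close>, so the usual descent inequality holds with the constant \<open>(sqrt \<kappa> + sqrt (5 \<nu> \<Delta>))^2\<close>.

  The block \<open>B\<close> is drawn with probability \<open>p_B\<close>, the square root of this constant divided by \<open>M\<close>.
  As \<open>a^2 / p_B^2\<close> is \<open>T'\<close> divided by the constant, the descent of \<open>F\<close> pays exactly
  for the quadratic term in the motion of \<open>v\<close>, outcome by outcome (\<open>potential_step\<close>), and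
  what remains is linear in the block gradient, so that averaging replaces it by the full
  gradient and convexity finishes the step (\<open>mean_potential_bound_le\<close>).

  For the number of steps, the recursion yields \<open>sqrt T' \<ge> sqrt T + 1 / (2 M)\<close>, where
  \<open>M = C0 + K / sqrt T\<close> with \<open>K = sqrt (5 \<Pi>) C1\<close>. While \<open>K\<close> dominates, \<open>sqrt T\<close> grows geometrically; afterwards it grows
  linearly. The function \<open>C0 * sqrt T + (K + 1) * ln (sqrt T)\<close> grows by at least one half per
  step in both regimes (\<open>\<Phi>_growth\<close>), and before the stopping index its total increase is at most the claimed
  expression, the logarithm of \<open>\<Pi> / (\<epsilon> T_0)\<close> being absorbed by the logarithmic factor.
\<close>

section \<open>Convex functions of one variable with curvature bounded on a sublevel set\<close>

lemma taylor2_upper: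
  fixes \<psi> \<psi>' \<psi>'' :: "real \<Rightarrow> real"
  assumes d1: "\<And>t. (\<psi> has_real_derivative \<psi>' t) (at t)"
    and d2: "\<And>t. (\<psi>' has_real_derivative \<psi>'' t) (at t)"
    and L: "\<And>t. 0 \<le> t \<Longrightarrow> t \<le> s \<Longrightarrow> \<psi>'' t \<le> L"
    and s: "0 \<le> s"
  shows "\<psi> s \<le> \<psi> 0 + s * \<psi>' 0 + L * s\<^sup>2 / 2"
proof (cases "s = 0")
  case False
  define diff where "diff = (\<lambda>m::nat. if m = 0 then \<psi> else if m = 1 then \<psi>' else \<psi>'')"
  have "\<exists>t. 0 < t \<and> t < s \<and> \<psi> s = (\<Sum>m<2. diff m 0 / fact m * s ^ m) + diff 2 t / fact 2 * s ^ 2"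
  proof (rule Maclaurin)
    show "\<forall>m t. m < 2 \<and> 0 \<le> t \<and> t \<le> s \<longrightarrow> DERIV (diff m) t :> diff (Suc m) t"
      using d1 d2 by (auto simp: diff_def less_2_cases_iff)
  qed (use s False in \<open>auto simp: diff_def\<close>)
  then obtain t where t: "0 < t" "t < s"
    and eq: "\<psi> s = (\<Sum>m<2. diff m 0 / fact m * s ^ m) + diff 2 t / fact 2 * s ^ 2"
    by blast
  have "\<psi> s = \<psi> 0 + s * \<psi>' 0 + \<psi>'' t * s\<^sup>2 / 2"
    using eq by (simp add: diff_def numeral_2_eq_2)
  moreover have "\<psi>'' t * s\<^sup>2 \<le> L * s\<^sup>2"
    using L[of t] t by (intro mult_right_mono) auto
  ultimately show ?thesis by simp
qed simp

lemma convex_on_le_max_endpoints: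
  fixes \<psi> :: "real \<Rightarrow> real"
  assumes "convex_on UNIV \<psi>" "a \<le> t" "t \<le> b" "\<psi> a \<le> m" "\<psi> b \<le> m"
  shows "\<psi> t \<le> m"
proof (cases "a = b")
  case False
  then have ab: "a < b" using assms by simp
  define w where "w = (t - a) / (b - a)"
  have w: "0 \<le> w" "w \<le> 1" using assms ab by (auto simp: w_def field_simps)
  have "w * (b - a) = t - a" using ab by (simp add: w_def)
  then have "t = (1 - w) * a + w * b" by (simp add: algebra_simps)
  then have "\<psi> t \<le> (1 - w) * \<psi> a + w * \<psi> b"
    using convex_onD[OF assms(1), of w a b] w by simp
  also have "\<dots> \<le> (1 - w) * m + w * m"
    using assms w by (intro add_mono mult_left_mono) auto
  finally show ?thesis by (simp add: algebra_simps)
qed (use assms in auto)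

text \<open>
  The gradient step of length \<open>1 / L\<close>, with the curvature controlled only on the initial sublevel
  set. If the step left that set, the function would return to its initial value at an earlier
  point; up to that point convexity keeps it in the sublevel set, and there the Taylor bound is
  strictly below the initial value.
\<close>

lemma descent_on_sublevel:
  fixes \<psi> \<psi>' \<psi>'' :: "real \<Rightarrow> real"
  assumes d1: "\<And>t. (\<psi> has_real_derivative \<psi>' t) (at t)"
    and d2: "\<And>t. (\<psi>' has_real_derivative \<psi>'' t) (at t)"
    and conv: "convex_on UNIV \<psi>"
    and L: "\<And>t. \<psi> t \<le> \<psi> 0 \<Longrightarrow> \<psi>'' t \<le> L" "L > 0"
    and g: "\<psi>' 0 = - g" "g > 0"
  shows "\<psi> (g / L) \<le> \<psi> 0 - g\<^sup>2 / (2 * L)"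
proof -
  define s where "s = g / L"
  have s: "s > 0" using L g by (simp add: s_def)
  have taylor: "\<psi> t \<le> \<psi> 0 - t * g + L * t\<^sup>2 / 2" if "0 \<le> t" "\<psi> t \<le> \<psi> 0" for t
  proof -
    have "\<psi>'' \<tau> \<le> L" if "0 \<le> \<tau>" "\<tau> \<le> t" for \<tau>
      using convex_on_le_max_endpoints[OF conv that, of "\<psi> 0"] \<open>\<psi> t \<le> \<psi> 0\<close> by (intro L) auto
    from taylor2_upper[OF d1 d2 this] that(1) show ?thesis by (simp add: g)
  qed
  have "\<psi> s \<le> \<psi> 0"
  proof (rule ccontr)
    assume neg: "\<not> \<psi> s \<le> \<psi> 0"
    \<comment> \<open>The function first decreases, so the return to the initial value happens at a positive time.\<close>
    obtain d where d: "d > 0" "\<And>h. 0 < h \<Longrightarrow> h < d \<Longrightarrow> \<psi> (0 + h) < \<psi> 0"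
      using DERIV_neg_dec_right[OF d1[of 0]] g by auto
    define h where "h = min (d / 2) (s / 2)"
    have h: "0 < h" "h < d" "h < s" using d s by (auto simp: h_def min_def field_simps)
    have "\<exists>x. h \<le> x \<and> x \<le> s \<and> \<psi> x = \<psi> 0"
      using d(2)[OF h(1,2)] neg h d1 by (intro IVT) (auto intro!: DERIV_isCont)
    then obtain \<tau> where \<tau>: "h \<le> \<tau>" "\<tau> \<le> s" "\<psi> \<tau> = \<psi> 0" by blast
    have "\<tau> \<noteq> s" using \<tau> neg by auto
    then have *: "0 < \<tau>" "\<tau> < s" using \<tau> h by auto
    have "0 \<le> - \<tau> * g + L * \<tau>\<^sup>2 / 2" using taylor[of \<tau>] \<tau> * by simp
    then have "0 \<le> \<tau> * (- g + L * \<tau> / 2)" by (simp add: power2_eq_square algebra_simps)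
    then have "g \<le> L * \<tau> / 2" using * by (simp add: zero_le_mult_iff)
    moreover have "L * \<tau> < g" using *(2) L by (simp add: s_def field_simps)
    ultimately show False using g by linarith
  qed
  from taylor[OF _ this] s have "\<psi> s \<le> \<psi> 0 - s * g + L * s\<^sup>2 / 2" by simp
  also have "\<dots> = \<psi> 0 - g\<^sup>2 / (2 * L)" using L by (simp add: s_def field_simps power2_eq_square)
  finally show ?thesis by (simp add: s_def)
qed

text \<open>
  A nonnegative function cannot decrease by more than its initial value in one gradient step.
\<close>

lemma slope_sq_le:
  fixes \<psi> \<psi>' \<psi>'' :: "real \<Rightarrow> real"
  assumes d1: "\<And>t. (\<psi> has_real_derivative \<psi>' t) (at t)"
    and d2: "\<And>t. (\<psi>' has_real_derivative \<psi>'' t) (at t)"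
    and conv: "convex_on UNIV \<psi>"
    and nonneg: "\<And>t. 0 \<le> \<psi> t"
    and L: "\<And>t. \<psi> t \<le> \<psi> 0 \<Longrightarrow> \<psi>'' t \<le> L" "L > 0"
    and pos: "\<psi>' 0 < 0"
  shows "(\<psi>' 0)\<^sup>2 \<le> 2 * L * \<psi> 0"
proof -
  have "0 \<le> \<psi> ((- \<psi>' 0) / L)" by (rule nonneg)
  also have "\<dots> \<le> \<psi> 0 - (- \<psi>' 0)\<^sup>2 / (2 * L)"
    by (rule descent_on_sublevel[OF d1 d2 conv L]) (use pos in auto)
  finally show ?thesis using L by (simp add: field_simps)
qed

text \<open>
  A bound on the curvature that is valid only below the level \<open>R\<close> still bounds the value at time 1, because
  the Taylor estimate stays below \<open>R\<close>: the value \<open>D\<close>, the slope at most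
  \<open>sqrt (2 * 2 * D * D) = 2 * D\<close> and the second-order term \<open>D\<close> add up to \<open>4 * D < R\<close>.
\<close>

lemma growth_on_sublevel:
  fixes \<psi> \<psi>' \<psi>'' :: "real \<Rightarrow> real"
  assumes d1: "\<And>t. (\<psi> has_real_derivative \<psi>' t) (at t)"
    and d2: "\<And>t. (\<psi>' has_real_derivative \<psi>'' t) (at t)"
    and conv: "convex_on UNIV \<psi>"
    and nonneg: "\<And>t. 0 \<le> \<psi> t"
    and L: "\<And>t. \<psi> t \<le> R \<Longrightarrow> \<psi>'' t \<le> 2 * D"
    and D: "D > 0" "4 * D < R" and start: "\<psi> 0 \<le> D"
  shows "\<psi> 1 \<le> 4 * D"
proof (rule ccontr)
  assume neg: "\<not> \<psi> 1 \<le> 4 * D"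
  have slope: "\<psi>' 0 \<le> 2 * D"
  proof (cases "\<psi>' 0 \<le> 0")
    case False
    \<comment> \<open>The slope bound for a decreasing function is applied to the function run backwards in time.\<close>
    define \<phi> where "\<phi> = (\<lambda>t. \<psi> (- t))"
    have refl: "((\<lambda>t. h (- t)) has_real_derivative - h' (- t)) (at t)"
      if "\<And>t. (h has_real_derivative h' t) (at t)" for h h' :: "real \<Rightarrow> real" and t
      using DERIV_chain2[where f = h and g = uminus and Db = "-1" and x = t and s = UNIV, OF that[of "- t"]]
        DERIV_minus[OF DERIV_ident, of t UNIV] by simp
    have e1: "(\<phi> has_real_derivative - \<psi>' (- t)) (at t)" for t
      unfolding \<phi>_def by (rule refl[OF d1])
    have e2: "((\<lambda>t. - \<psi>' (- t)) has_real_derivative \<psi>'' (- t)) (at t)" for t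
      using DERIV_minus[OF refl[OF d2, of t]] by simp
    have "convex_on UNIV \<phi>"
    proof (intro convex_onI)
      fix t x y :: real assume "0 < t" "t < 1"
      then show "\<phi> ((1 - t) *\<^sub>R x + t *\<^sub>R y) \<le> (1 - t) * \<phi> x + t * \<phi> y"
        using convex_onD[OF conv, of t "-x" "-y"] by (simp add: \<phi>_def algebra_simps)
    qed simp
    then have "(- \<psi>' (- 0))\<^sup>2 \<le> 2 * (2 * D) * \<phi> 0"
    proof (rule slope_sq_le[OF e1 e2])
      show "\<psi>'' (- t) \<le> 2 * D" if "\<phi> t \<le> \<phi> 0" for t
        using that start D by (intro L) (simp add: \<phi>_def)
      show "0 \<le> \<phi> t" for t using nonneg by (simp add: \<phi>_def)
      show "0 < 2 * D" using D by simp
      show "- \<psi>' (- 0) < 0" using False by simp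
    qed
    then have "(\<psi>' 0)\<^sup>2 \<le> 2 * (2 * D) * \<psi> 0"
      by (simp only: minus_zero power2_minus \<phi>_def)
    also have "\<dots> \<le> 2 * (2 * D) * D"
      using start D(1) by (intro mult_left_mono) auto
    also have "\<dots> = (2 * D)\<^sup>2" by (simp only: power2_eq_square mult.assoc mult.left_commute)
    finally have "\<psi>' 0 \<le> 2 * D" by (rule power2_le_imp_le) (use D(1) in simp)
    then show ?thesis .
  qed (use D in auto)
  \<comment> \<open>A level above the claimed bound that is attained while the curvature bound still holds.\<close>
  define c where "c = min (\<psi> 1) R"
  have c: "4 * D < c" "c \<le> \<psi> 1" "c \<le> R" using neg D by (auto simp: c_def)
  have "\<exists>x. 0 \<le> x \<and> x \<le> 1 \<and> \<psi> x = c"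
    using start D c d1 by (intro IVT) (auto intro!: DERIV_isCont)
  then obtain \<tau> where \<tau>: "0 \<le> \<tau>" "\<tau> \<le> 1" "\<psi> \<tau> = c" by blast
  have "\<psi>'' t \<le> 2 * D" if "0 \<le> t" "t \<le> \<tau>" for t
    using convex_on_le_max_endpoints[OF conv that, of R] start D c \<tau> by (intro L) auto
  from taylor2_upper[OF d1 d2 this \<tau>(1)]
  have "c \<le> \<psi> 0 + \<tau> * \<psi>' 0 + D * \<tau>\<^sup>2" using \<tau> by simp
  moreover have "\<tau> * \<psi>' 0 \<le> 2 * D"
    using \<tau> slope D mult_mono[of \<tau> 1 "\<psi>' 0" "2*D"] mult_nonneg_nonpos[of \<tau> "\<psi>' 0"]
    by (cases "\<psi>' 0 \<ge> 0") auto
  moreover have "D * \<tau>\<^sup>2 \<le> D" using \<tau> D by (simp add: power_le_one mult_left_le)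
  ultimately show False using c start by linarith
qed

section \<open>Quadratic forms, blocks and derivatives on lines\<close>

text \<open>
  The square root of a positive semidefinite quadratic form is a seminorm. Only the symmetrization
  of \<open>H\<close> enters, so this holds for every matrix \<open>H\<close> with a nonnegative form. Shifting both roots by
  \<open>e / 2\<close> makes the weights in the Cauchy-Schwarz argument positive, which avoids a case distinction.
\<close>

lemma sqrt_quadratic_form_triangle:
  fixes H :: "real^'m^'m"
  assumes psd: "\<And>x. 0 \<le> x \<bullet> (H *v x)"
  shows "sqrt ((x + y) \<bullet> (H *v (x + y))) \<le> sqrt (x \<bullet> (H *v x)) + sqrt (y \<bullet> (H *v y))"
proof (rule field_le_epsilon)
  fix e :: real assume "e > 0"
  define \<alpha> \<beta> where "\<alpha> = sqrt (x \<bullet> (H *v x)) + e / 2" and "\<beta> = sqrt (y \<bullet> (H *v y)) + e / 2"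
  define b where "b = x \<bullet> (H *v y) + y \<bullet> (H *v x)"
  have pos: "\<alpha> > 0" "\<beta> > 0"
    using \<open>e > 0\<close> psd by (auto simp: \<alpha>_def \<beta>_def add_nonneg_pos)
  have qx: "x \<bullet> (H *v x) \<le> \<alpha>\<^sup>2" and qy: "y \<bullet> (H *v y) \<le> \<beta>\<^sup>2"
    using \<open>e > 0\<close> psd by (auto simp: \<alpha>_def \<beta>_def intro!: sqrt_le_D)
  have "0 \<le> (\<beta> *\<^sub>R x - \<alpha> *\<^sub>R y) \<bullet> (H *v (\<beta> *\<^sub>R x - \<alpha> *\<^sub>R y))" by (rule psd)
  also have "\<dots> = \<beta>\<^sup>2 * (x \<bullet> (H *v x)) + \<alpha>\<^sup>2 * (y \<bullet> (H *v y)) - \<alpha> * \<beta> * b"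
    by (simp add: b_def matrix_vector_mult_diff_distrib matrix_vector_mult_scaleR inner_diff_left
        inner_diff_right power2_eq_square algebra_simps)
  also have "\<dots> \<le> \<beta>\<^sup>2 * \<alpha>\<^sup>2 + \<alpha>\<^sup>2 * \<beta>\<^sup>2 - \<alpha> * \<beta> * b"
    using qx qy by (intro diff_right_mono add_mono mult_left_mono) auto
  also have "\<dots> = \<alpha> * \<beta> * (2 * \<alpha> * \<beta> - b)" by (simp add: power2_eq_square algebra_simps)
  finally have "0 \<le> \<alpha> * \<beta> * (2 * \<alpha> * \<beta> - b)" .
  moreover have "0 < \<alpha> * \<beta>" using pos by simp
  ultimately have "b \<le> 2 * \<alpha> * \<beta>" by (metis diff_ge_0_iff_ge zero_le_mult_iff linorder_not_less)
  moreover have "(x + y) \<bullet> (H *v (x + y)) = x \<bullet> (H *v x) + b + y \<bullet> (H *v y)"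
    by (simp add: b_def matrix_vector_right_distrib inner_add_left inner_add_right)
  ultimately have "(x + y) \<bullet> (H *v (x + y)) \<le> (\<alpha> + \<beta>)\<^sup>2"
    using qx qy by (simp add: power2_sum)
  then have "sqrt ((x + y) \<bullet> (H *v (x + y))) \<le> \<alpha> + \<beta>"
    using pos by (intro real_le_lsqrt) auto
  then show "sqrt ((x + y) \<bullet> (H *v (x + y)))
      \<le> sqrt (x \<bullet> (H *v x)) + sqrt (y \<bullet> (H *v y)) + e"
    by (simp add: \<alpha>_def \<beta>_def)
qed

lemma sqrt_quadratic_form_sum_le:
  fixes H :: "real^'m^'m"
  assumes psd: "\<And>x. 0 \<le> x \<bullet> (H *v x)" and "finite S"
  shows "sqrt ((\<Sum>i\<in>S. x i) \<bullet> (H *v (\<Sum>i\<in>S. x i))) \<le> (\<Sum>i\<in>S. sqrt (x i \<bullet> (H *v x i)))"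
  using \<open>finite S\<close>
proof induction
  case (insert i S)
  then show ?case
    using sqrt_quadratic_form_triangle[OF psd, of "x i" "\<Sum>i\<in>S. x i"] by simp
qed simp

definition block_part :: "'m set \<Rightarrow> real^'m \<Rightarrow> real^'m" where
  "block_part B x = (\<chi> i. if i \<in> B then x $ i else 0)"

lemma block_gradient_eq: "block_gradient B f x = block_part B (gradient f x)"
  by (simp add: block_gradient_def block_part_def vec_eq_iff)

lemma inner_block_part: "x \<bullet> block_part B y = block_part B x \<bullet> block_part B y"
  by (auto simp: block_part_def inner_vec_def intro!: sum.cong)

lemma norm_block_part_le: "norm (block_part B x) \<le> norm x"
  by (intro norm_le_componentwise_cart) (auto simp: block_part_def)

lemma sum_block_part:
  fixes x :: "real^'m"
  assumes "partition_on UNIV \<B>"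
  shows "(\<Sum>B\<in>\<B>. block_part B x) = x"
proof (subst vec_eq_iff, intro allI)
  fix i
  obtain B where B: "B \<in> \<B>" "i \<in> B" using partition_onD1[OF assms] by auto
  have uniq: "i \<in> B' \<longleftrightarrow> B' = B" if "B' \<in> \<B>" for B'
    using disjointD[OF partition_onD2[OF assms] that B(1)] B(2) by auto
  have "(\<Sum>B\<in>\<B>. block_part B x) $ i = (\<Sum>B'\<in>\<B>. if B' = B then x $ i else 0)"
    using uniq by (auto simp: block_part_def intro!: sum.cong)
  then show "(\<Sum>B\<in>\<B>. block_part B x) $ i = x $ i" using B by simp
qed

lemma block_hessian_quadratic_form:
  "block_part B x \<bullet> (block_hessian B f y *v block_part B x)
     = block_part B x \<bullet> (hessian f y *v block_part B x)"
  by (auto simp: block_part_def block_hessian_def inner_vec_def matrix_vector_mult_def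
      intro!: sum.cong)

lemma block_identity_quadratic_form:
  "block_part B x \<bullet> ((c *\<^sub>R block_identity B) *v block_part B x) = c * (norm (block_part B x))\<^sup>2"
  (is "?l = _")
proof -
  have "((c *\<^sub>R block_identity B) *v block_part B x) $ i = c * block_part B x $ i" for i
  proof -
    have "((c *\<^sub>R block_identity B) *v block_part B x) $ i
        = (\<Sum>j\<in>UNIV. if j = i then c * block_part B x $ i else 0)"
      unfolding matrix_vector_mult_def vec_lambda_beta
      by (rule sum.cong) (auto simp: block_identity_def block_part_def)
    then show ?thesis by simp
  qed
  then have "(c *\<^sub>R block_identity B) *v block_part B x = c *\<^sub>R block_part B x"
    by (simp add: vec_eq_iff)
  then show ?thesis by (simp add: power2_norm_eq_inner)
qed

lemma C2_gradient_works:
  assumes "C2_function f"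
  shows "(f has_derivative (\<lambda>h. gradient f x \<bullet> h)) (at x)"
proof -
  from assms have d: "(f has_derivative frechet_derivative f (at x)) (at x)"
    by (simp add: C2_function_def frechet_derivative_works)
  then have lin: "linear (frechet_derivative f (at x))" by (rule has_derivative_linear)
  have "frechet_derivative f (at x) h = gradient f x \<bullet> h" for h
  proof -
    have "frechet_derivative f (at x) h = frechet_derivative f (at x) (\<Sum>i\<in>UNIV. (h $ i) *\<^sub>R axis i 1)"
      using basis_expansion[of h] by (simp add: scalar_mult_eq_scaleR)
    also have "\<dots> = gradient f x \<bullet> h"
      by (simp add: linear_sum[OF lin] linear_scale[OF lin] gradient_def inner_vec_def mult.commute)
    finally show ?thesis .
  qed
  then have "frechet_derivative f (at x) = (\<lambda>h. gradient f x \<bullet> h)" by auto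
  with d show ?thesis by simp
qed

lemma C2_derivatives_on_line:
  assumes "C2_function f"
  shows "((\<lambda>t. f (x + t *\<^sub>R h)) has_real_derivative gradient f (x + t *\<^sub>R h) \<bullet> h) (at t)"
    and "((\<lambda>t. gradient f (x + t *\<^sub>R h) \<bullet> h) has_real_derivative
           h \<bullet> (hessian f (x + t *\<^sub>R h) *v h)) (at t)"
proof -
  have line: "((\<lambda>t. x + t *\<^sub>R h) has_derivative (\<lambda>s. s *\<^sub>R h)) (at t)"
    by (auto intro!: derivative_eq_intros)
  from has_derivative_compose[OF line C2_gradient_works[OF assms]]
  have "((\<lambda>t. f (x + t *\<^sub>R h)) has_derivative (\<lambda>s. gradient f (x + t *\<^sub>R h) \<bullet> s *\<^sub>R h)) (at t)" .
  moreover have "(\<lambda>s. gradient f (x + t *\<^sub>R h) \<bullet> s *\<^sub>R h) = (*) (gradient f (x + t *\<^sub>R h) \<bullet> h)"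
    by (auto simp: mult.commute)
  ultimately show "((\<lambda>t. f (x + t *\<^sub>R h)) has_real_derivative gradient f (x + t *\<^sub>R h) \<bullet> h) (at t)"
    unfolding has_field_derivative_def by simp
  have "(gradient f has_derivative (\<lambda>w. hessian f y *v w)) (at y)" for y
    using assms jacobian_works[of "gradient f" "at y"] by (auto simp: C2_function_def hessian_def)
  from has_derivative_inner_left[OF has_derivative_compose[OF line this], of h]
  have "((\<lambda>t. gradient f (x + t *\<^sub>R h) \<bullet> h) has_derivative
          (\<lambda>s. (hessian f (x + t *\<^sub>R h) *v (s *\<^sub>R h)) \<bullet> h)) (at t)" .
  moreover have "(\<lambda>s. (hessian f (x + t *\<^sub>R h) *v (s *\<^sub>R h)) \<bullet> h)
      = (*) (h \<bullet> (hessian f (x + t *\<^sub>R h) *v h))"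
    by (auto simp: matrix_vector_mult_scaleR inner_commute)
  ultimately show "((\<lambda>t. gradient f (x + t *\<^sub>R h) \<bullet> h) has_real_derivative
           h \<bullet> (hessian f (x + t *\<^sub>R h) *v h)) (at t)"
    unfolding has_field_derivative_def by simp
qed

lemma convex_on_line:
  assumes "convex_on UNIV f"
  shows "convex_on UNIV (\<lambda>t::real. f (x + t *\<^sub>R h) - c)"
proof (intro convex_onI)
  fix t a b :: real assume "0 < t" "t < 1"
  moreover have "x + ((1 - t) * a + t * b) *\<^sub>R h = (1 - t) *\<^sub>R (x + a *\<^sub>R h) + t *\<^sub>R (x + b *\<^sub>R h)"
    by (simp add: algebra_simps)
  ultimately show "f (x + ((1 - t) *\<^sub>R a + t *\<^sub>R b) *\<^sub>R h) - c
      \<le> (1 - t) * (f (x + a *\<^sub>R h) - c) + t * (f (x + b *\<^sub>R h) - c)"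
    using convex_onD[OF assms, of t "x + a *\<^sub>R h" "x + b *\<^sub>R h"] by (simp add: algebra_simps)
qed simp

lemma convex_gradient_inequality:
  assumes "convex_on UNIV f" "C2_function f"
  shows "f x + gradient f x \<bullet> (y - x) \<le> f y"
proof -
  have "(\<lambda>t. f (x + t *\<^sub>R (y - x)) - 0) 1 - (\<lambda>t. f (x + t *\<^sub>R (y - x)) - 0) 0
      \<ge> (gradient f x \<bullet> (y - x)) * (1 - 0)"
    using C2_derivatives_on_line(1)[OF assms(2), of x "y - x" 0]
    by (intro convex_on_imp_above_tangent[OF convex_on_line[OF assms(1)]])
      (auto simp: has_field_derivative_at_within)
  then show ?thesis by simp
qed

lemma convex_hessian_psd:
  assumes "convex_on UNIV f" "C2_function f"
  shows "0 \<le> h \<bullet> (hessian f x *v h)"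
proof -
  have "mono_on UNIV (\<lambda>t. gradient f (x + t *\<^sub>R h) \<bullet> h)"
  proof (intro mono_onI)
    fix s t :: real assume "s \<le> t"
    have "gradient f (x + s *\<^sub>R h) \<bullet> ((t - s) *\<^sub>R h) \<le> gradient f (x + t *\<^sub>R h) \<bullet> ((t - s) *\<^sub>R h)"
      using convex_gradient_inequality[OF assms, of "x + s *\<^sub>R h" "x + t *\<^sub>R h"]
        convex_gradient_inequality[OF assms, of "x + t *\<^sub>R h" "x + s *\<^sub>R h"]
      by (simp add: algebra_simps)
    then show "gradient f (x + s *\<^sub>R h) \<bullet> h \<le> gradient f (x + t *\<^sub>R h) \<bullet> h"
      using \<open>s \<le> t\<close> by (cases "s = t") auto
  qed
  from mono_on_imp_deriv_nonneg[OF this C2_derivatives_on_line(2)[OF assms(2), of x h 0]]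
  show ?thesis by simp
qed

section \<open>Functions whose block curvature is bounded by the gap\<close>

locale block_smooth =
  fixes f :: "real^'m \<Rightarrow> real" and fstar :: real
    and \<B> :: "'m set set" and \<kappa> \<nu> :: "'m set \<Rightarrow> real"
  assumes convex: "convex_on UNIV f"
    and C2: "C2_function f"
    and fstar_le: "fstar \<le> f x"
    and partition: "partition_on UNIV \<B>"
    and \<kappa>_nonneg: "B \<in> \<B> \<Longrightarrow> 0 \<le> \<kappa> B"
    and \<nu>_nonneg: "B \<in> \<B> \<Longrightarrow> 0 \<le> \<nu> B"
    and curvature: "B \<in> \<B> \<Longrightarrow>
      loewner_le (block_hessian B f x) ((\<kappa> B + \<nu> B * (f x - fstar)) *\<^sub>R block_identity B)"
begin

lemma finite_\<B>: "finite \<B>"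
  using finite_elements[OF _ partition] by simp

definition "C0 = (\<Sum>B\<in>\<B>. sqrt (\<kappa> B))"
definition "C1 = (\<Sum>B\<in>\<B>. sqrt (\<nu> B))"

lemma C1_nonneg: "0 \<le> C1"
  by (auto simp: C1_def \<nu>_nonneg intro!: sum_nonneg)

lemma block_curvature:
  assumes "B \<in> \<B>"
  shows "block_part B h \<bullet> (hessian f x *v block_part B h)
    \<le> (\<kappa> B + \<nu> B * (f x - fstar)) * (norm (block_part B h))\<^sup>2"
  using curvature[OF assms, of x] unfolding loewner_le_def
  by (metis block_hessian_quadratic_form block_identity_quadratic_form)

text \<open>
  Blockwise bounds control the whole Hessian: by the triangle inequality for the seminorm of the Hessian,
  the square roots of the block constants add up.
\<close>

lemma full_curvature:
  assumes R: "f x - fstar \<le> R"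
  shows "h \<bullet> (hessian f x *v h) \<le> (C0 + sqrt R * C1)\<^sup>2 * (norm h)\<^sup>2"
proof -
  have R0: "0 \<le> R" using R fstar_le[of x] by simp
  have block: "sqrt (block_part B h \<bullet> (hessian f x *v block_part B h))
      \<le> (sqrt (\<kappa> B) + sqrt R * sqrt (\<nu> B)) * norm h" if B: "B \<in> \<B>" for B
  proof (rule real_le_lsqrt)
    have "\<kappa> B + \<nu> B * (f x - fstar) \<le> \<kappa> B + R * \<nu> B"
      using mult_right_mono[OF R \<nu>_nonneg[OF B]] by (simp add: mult.commute)
    also have "\<dots> \<le> (sqrt (\<kappa> B) + sqrt R * sqrt (\<nu> B))\<^sup>2"
      using \<kappa>_nonneg[OF B] \<nu>_nonneg[OF B] R0 by (simp add: power2_sum power_mult_distrib)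
    finally have coeff: "\<kappa> B + \<nu> B * (f x - fstar) \<le> (sqrt (\<kappa> B) + sqrt R * sqrt (\<nu> B))\<^sup>2" .
    have "block_part B h \<bullet> (hessian f x *v block_part B h)
        \<le> (\<kappa> B + \<nu> B * (f x - fstar)) * (norm (block_part B h))\<^sup>2"
      by (rule block_curvature[OF B])
    also have "\<dots> \<le> (sqrt (\<kappa> B) + sqrt R * sqrt (\<nu> B))\<^sup>2 * (norm h)\<^sup>2"
      using coeff norm_block_part_le[of B h] by (intro mult_mono power_mono) auto
    finally show "block_part B h \<bullet> (hessian f x *v block_part B h)
        \<le> ((sqrt (\<kappa> B) + sqrt R * sqrt (\<nu> B)) * norm h)\<^sup>2"
      by (simp add: power_mult_distrib)
  qed (use \<kappa>_nonneg[OF B] \<nu>_nonneg[OF B] R0 in auto)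
  have "sqrt (h \<bullet> (hessian f x *v h))
      \<le> (\<Sum>B\<in>\<B>. sqrt (block_part B h \<bullet> (hessian f x *v block_part B h)))"
    using sqrt_quadratic_form_sum_le[where H = "hessian f x" and x = "\<lambda>B. block_part B h",
        OF convex_hessian_psd[OF convex C2] finite_\<B>] sum_block_part[OF partition, of h] by simp
  also have "\<dots> \<le> (\<Sum>B\<in>\<B>. (sqrt (\<kappa> B) + sqrt R * sqrt (\<nu> B)) * norm h)"
    by (intro sum_mono block)
  also have "\<dots> = (C0 + sqrt R * C1) * norm h"
    by (simp add: C0_def C1_def sum.distrib sum_distrib_left sum_distrib_right algebra_simps)
  finally show ?thesis
    by (metis power_mult_distrib sqrt_le_D)
qed

text \<open>
  On the sublevel set of \<open>y\<close> the curvature bound \<open>\<kappa> B + \<nu> B * (f - fstar)\<close> is at most its value at \<open>y\<close>, so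
  one constant serves for the whole step.
\<close>

lemma block_descent:
  assumes B: "B \<in> \<B>" and L: "\<kappa> B + \<nu> B * (f y - fstar) \<le> L" "0 < L"
  shows "f (y - (1 / L) *\<^sub>R block_gradient B f y)
           \<le> f y - (norm (block_gradient B f y))\<^sup>2 / (2 * L)"
proof (cases "block_gradient B f y = 0")
  case False
  define g where "g = block_gradient B f y"
  define \<psi> where "\<psi> = (\<lambda>t. f (y + t *\<^sub>R - g) - fstar)"
  have g: "0 < norm g" using False by (simp add: g_def)
  have "\<psi> ((norm g)\<^sup>2 / (L * (norm g)\<^sup>2))
      \<le> \<psi> 0 - ((norm g)\<^sup>2)\<^sup>2 / (2 * (L * (norm g)\<^sup>2))"
  proof (rule descent_on_sublevel)
    show "(\<psi> has_real_derivative gradient f (y + t *\<^sub>R - g) \<bullet> - g) (at t)" for t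
      unfolding \<psi>_def
      using DERIV_diff[OF C2_derivatives_on_line(1)[OF C2, of y "- g" t] DERIV_const[of fstar "at t"]]
      by (simp only: diff_0_right)
    show "((\<lambda>t. gradient f (y + t *\<^sub>R - g) \<bullet> - g) has_real_derivative
        - g \<bullet> (hessian f (y + t *\<^sub>R - g) *v - g)) (at t)" for t
      by (rule C2_derivatives_on_line(2)[OF C2])
    show "convex_on UNIV \<psi>"
      unfolding \<psi>_def by (rule convex_on_line[OF convex])
    have "gradient f y \<bullet> g = g \<bullet> g"
      unfolding g_def block_gradient_eq by (rule inner_block_part)
    then show "gradient f (y + 0 *\<^sub>R - g) \<bullet> - g = - (norm g)\<^sup>2"
      by (simp add: power2_norm_eq_inner)
    fix t assume "\<psi> t \<le> \<psi> 0"
    then have le: "f (y + t *\<^sub>R - g) - fstar \<le> f y - fstar" by (simp add: \<psi>_def)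
    have "- g = block_part B (- gradient f y)"
      by (simp add: g_def block_gradient_eq block_part_def vec_eq_iff)
    then have "- g \<bullet> (hessian f (y + t *\<^sub>R - g) *v - g)
        \<le> (\<kappa> B + \<nu> B * (f (y + t *\<^sub>R - g) - fstar)) * (norm (- g))\<^sup>2"
      using block_curvature[OF B, of "- gradient f y" "y + t *\<^sub>R - g"] by simp
    also have "\<dots> \<le> (\<kappa> B + \<nu> B * (f y - fstar)) * (norm (- g))\<^sup>2"
      using le \<nu>_nonneg[OF B] by (intro mult_right_mono add_left_mono mult_left_mono) auto
    also have "\<dots> \<le> L * (norm g)\<^sup>2"
      using L by (simp add: mult_right_mono)
    finally show "- g \<bullet> (hessian f (y + t *\<^sub>R - g) *v - g) \<le> L * (norm g)\<^sup>2" .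
  qed (use L g in auto)
  moreover have "(norm g)\<^sup>2 / (L * (norm g)\<^sup>2) = 1 / L"
    "((norm g)\<^sup>2)\<^sup>2 / (2 * (L * (norm g)\<^sup>2)) = (norm g)\<^sup>2 / (2 * L)"
    using g L by (simp_all add: field_simps power2_eq_square)
  ultimately show ?thesis by (simp add: \<psi>_def g_def)
qed simp

text \<open>
  Blocks that are never drawn do not contribute to the gradient, since along them \<open>f\<close> is affine and
  bounded below. Otherwise the mean over the drawn blocks would miss a part of the gradient.
\<close>

lemma block_gradient_eq_0:
  assumes B: "B \<in> \<B>" and zero: "\<kappa> B = 0" "\<nu> B = 0"
  shows "block_gradient B f y = 0"
proof (rule ccontr)
  assume "block_gradient B f y \<noteq> 0"
  define n where "n = (norm (block_gradient B f y))\<^sup>2"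
  \<comment> \<open>A step constant so small that the guaranteed decrease exceeds the gap by one.\<close>
  define L where "L = n / (2 * (f y - fstar + 1))"
  have n: "0 < n" using \<open>block_gradient B f y \<noteq> 0\<close> by (simp add: n_def)
  have L: "0 < L" using n fstar_le[of y] by (auto simp: L_def intro!: divide_pos_pos)
  have "fstar \<le> f y - n / (2 * L)"
    using block_descent[OF B _ L, of y] zero L fstar_le[of "y - (1 / L) *\<^sub>R block_gradient B f y"]
    by (simp add: n_def)
  also have "n / (2 * L) = f y - fstar + 1"
    using n fstar_le[of y] by (simp add: L_def)
  finally show False by simp
qed

text \<open>
  The bound on the potential controls the value at the coupling point \<open>y\<close>. Here \<open>y\<close> is
  reached from \<open>x0\<close>, the same combination with \<open>w\<close> replaced by the minimizer, whose gap is at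
  most \<open>\<pi> / (T + a)\<close>. Where the gap is at most \<open>5 * \<pi> / T\<close>, the curvature along the segment is at most
  \<open>M\<^sup>2 * a\<^sup>2 / (T + a)\<^sup>2\<close> times \<open>(norm (w - ustar))\<^sup>2\<close>, and the equation for \<open>a\<close> turns
  this into \<open>2 * \<pi> / (T + a)\<close>.
\<close>

lemma coupling_point_gap:
  assumes us: "f ustar = fstar"
    and T: "0 < T" "0 < a" and pi: "0 < \<pi>"
    and M: "M = rate C0 C1 (\<pi> / T)" and a: "M\<^sup>2 * a\<^sup>2 = T + a"
    and E: "T * (f x - fstar) + (norm (w - ustar))\<^sup>2 / 2 \<le> \<pi>"
    and y: "y = (1 / (T + a)) *\<^sub>R (T *\<^sub>R x + a *\<^sub>R w)"
  shows "f y - fstar \<le> 4 * (\<pi> / (T + a))"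
proof -
  define T' where "T' = T + a"
  have T': "T < T'" "0 < T'" using T by (auto simp: T'_def)
  define D where "D = \<pi> / T'"
  define h where "h = (a / T') *\<^sub>R (w - ustar)"
  define x0 where "x0 = (1 - a / T') *\<^sub>R x + (a / T') *\<^sub>R ustar"
  have Tq: "1 - a / T' = T / T'" using T' by (simp add: T'_def field_simps)
  have yx: "y = x0 + h"
    unfolding y x0_def h_def T'_def[symmetric] Tq by (simp add: algebra_simps)
  have gap: "0 \<le> T * (f x - fstar)" using T fstar_le[of x] by simp
  define \<psi> where "\<psi> = (\<lambda>t. f (x0 + t *\<^sub>R h) - fstar)"
  have "\<psi> 1 \<le> 4 * D"
  proof (rule growth_on_sublevel)
    show "(\<psi> has_real_derivative gradient f (x0 + t *\<^sub>R h) \<bullet> h) (at t)" for t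
      unfolding \<psi>_def
      using DERIV_diff[OF C2_derivatives_on_line(1)[OF C2, of x0 h t] DERIV_const[of fstar "at t"]]
      by (simp only: diff_0_right)
    show "((\<lambda>t. gradient f (x0 + t *\<^sub>R h) \<bullet> h) has_real_derivative
        h \<bullet> (hessian f (x0 + t *\<^sub>R h) *v h)) (at t)" for t
      by (rule C2_derivatives_on_line(2)[OF C2])
    show "convex_on UNIV \<psi>"
      unfolding \<psi>_def by (rule convex_on_line[OF convex])
    show "0 \<le> \<psi> t" for t using fstar_le by (simp add: \<psi>_def)
    show "0 < D" using pi T' by (simp add: D_def)
    have "\<pi> / T' < \<pi> / T" using T T' pi by (intro divide_strict_left_mono) auto
    then show "4 * D < 5 * (\<pi> / T)"
      using pi T unfolding D_def by (smt (verit) divide_pos_pos)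
    have "f x0 \<le> (1 - a / T') * f x + (a / T') * f ustar"
      unfolding x0_def using T T' by (intro convex_onD[OF convex]) (auto simp: T'_def)
    then have "\<psi> 0 \<le> (T / T') * (f x - fstar)"
      by (simp add: \<psi>_def us Tq[symmetric] algebra_simps)
    also have "\<dots> \<le> D"
    proof -
      have "T * (f x - fstar) \<le> \<pi>" using E zero_le_power2[of "norm (w - ustar)"] by linarith
      then show ?thesis using T' by (simp add: D_def divide_right_mono)
    qed
    finally show "\<psi> 0 \<le> D" .
    fix t assume "\<psi> t \<le> 5 * (\<pi> / T)"
    then have "h \<bullet> (hessian f (x0 + t *\<^sub>R h) *v h) \<le> M\<^sup>2 * (norm h)\<^sup>2"
      using full_curvature[of "x0 + t *\<^sub>R h" "5 * (\<pi> / T)" h] by (simp add: \<psi>_def M rate_def)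
    also have "\<dots> = M\<^sup>2 * a\<^sup>2 * (norm (w - ustar))\<^sup>2 / T'\<^sup>2"
      using T T' by (simp add: h_def power_mult_distrib power_divide)
    also have "\<dots> = (norm (w - ustar))\<^sup>2 / T'"
      using T' unfolding a T'_def[symmetric] by (simp add: power2_eq_square)
    also have "\<dots> \<le> 2 * D"
      using E gap T' by (simp add: D_def divide_right_mono)
    finally show "h \<bullet> (hessian f (x0 + t *\<^sub>R h) *v h) \<le> 2 * D" .
  qed
  then show ?thesis by (simp add: \<psi>_def yx D_def T'_def)
qed

text \<open>
  The square root of the step constant of a block. These roots, rather than the constants themselves, add up to
  the rate, which makes them the right sampling weights.
\<close>

definition block_rate :: "real \<Rightarrow> 'm set \<Rightarrow> real" where
  "block_rate \<Delta> B = sqrt (\<kappa> B) + sqrt (5 * \<nu> B * \<Delta>)"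

lemma block_rate_nonneg: "B \<in> \<B> \<Longrightarrow> 0 \<le> \<Delta> \<Longrightarrow> 0 \<le> block_rate \<Delta> B"
  by (simp add: block_rate_def \<kappa>_nonneg \<nu>_nonneg)

lemma sum_block_rate: "(\<Sum>B\<in>\<B>. block_rate \<Delta> B) = rate C0 C1 \<Delta>"
proof -
  have "sqrt (5 * \<nu> B * \<Delta>) = sqrt (5 * \<Delta>) * sqrt (\<nu> B)" for B
    by (simp add: real_sqrt_mult algebra_simps)
  then show ?thesis
    by (simp add: block_rate_def rate_def C0_def C1_def sum.distrib sum_distrib_left)
qed

definition potential :: "real \<Rightarrow> real^'m \<Rightarrow> real^'m \<Rightarrow> real^'m \<Rightarrow> real" where
  "potential T ustar x w = T * (f x - fstar) + (norm (w - ustar))\<^sup>2 / 2"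

text \<open>
  What remains of the potential after a step in block \<open>B\<close> once the decrease of the function value
  has absorbed the squared length of the step. It is affine in the block gradient, and it depends
  on the drawn block but not on the new iterates.
\<close>

definition potential_bound ::
  "real \<Rightarrow> real \<Rightarrow> real \<Rightarrow> real^'m \<Rightarrow> 'm set \<Rightarrow> real^'m \<Rightarrow> real^'m \<Rightarrow> real" where
  "potential_bound T a p ustar B y w =
     (T + a) * (f y - fstar) + (norm (w - ustar))\<^sup>2 / 2
       - (a / p) * (block_gradient B f y \<bullet> (w - ustar))"

lemma potential_nonneg: "0 \<le> T \<Longrightarrow> 0 \<le> potential T ustar x w"
  using fstar_le[of x] by (simp add: potential_def)

text \<open>
  With \<open>c = a / p\<close>, the equation for \<open>a\<close> says \<open>c\<^sup>2 = (T + a) / (block_rate \<Delta> B)\<^sup>2\<close>. Hence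
  the guaranteed decrease of \<open>(T + a) * f\<close> equals \<open>c\<^sup>2 * (norm g)\<^sup>2 / 2\<close>, the quadratic term of the
  squared distance of \<open>w - c *\<^sub>R g\<close> to the minimizer.
\<close>

lemma potential_step:
  assumes B: "B \<in> \<B>" and T: "0 < T" "0 < a" and M: "0 < M" and \<Delta>: "0 \<le> \<Delta>"
    and a: "M\<^sup>2 * a\<^sup>2 = T + a"
    and y: "f y - fstar \<le> 5 * \<Delta>"
    and p: "0 < block_rate \<Delta> B"
    and x': "f x' \<le> f (y - (1 / (block_rate \<Delta> B)\<^sup>2) *\<^sub>R block_gradient B f y)"
  shows "potential (T + a) ustar x'
           (w - (a / (block_rate \<Delta> B / M)) *\<^sub>R block_gradient B f y)
         \<le> potential_bound T a (block_rate \<Delta> B / M) ustar B y w"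
proof -
  define g where "g = block_gradient B f y"
  define l where "l = block_rate \<Delta> B"
  define c where "c = a / (l / M)"
  have l: "0 < l" using p by (simp add: l_def)
  have c2: "c\<^sup>2 = (T + a) / l\<^sup>2"
    using a l M by (simp add: c_def power_divide power_mult_distrib mult.commute)
  have "\<kappa> B + \<nu> B * (f y - fstar) \<le> \<kappa> B + 5 * \<nu> B * \<Delta>"
    using mult_left_mono[OF y \<nu>_nonneg[OF B]] by (simp add: algebra_simps)
  also have "\<dots> \<le> l\<^sup>2"
    using \<kappa>_nonneg[OF B] \<nu>_nonneg[OF B] \<Delta> by (simp add: l_def block_rate_def power2_sum)
  finally have "f x' \<le> f y - (norm g)\<^sup>2 / (2 * l\<^sup>2)"
    using block_descent[OF B, of y "l\<^sup>2"] x' l by (simp add: g_def l_def)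
  then have "f x' - fstar \<le> f y - fstar - (norm g)\<^sup>2 / (2 * l\<^sup>2)" by simp
  then have "(T + a) * (f x' - fstar) \<le> (T + a) * (f y - fstar - (norm g)\<^sup>2 / (2 * l\<^sup>2))"
    using T by (intro mult_left_mono) auto
  also have "\<dots> = (T + a) * (f y - fstar) - c\<^sup>2 * (norm g)\<^sup>2 / 2"
    by (simp add: c2 algebra_simps)
  finally have "(T + a) * (f x' - fstar) \<le> (T + a) * (f y - fstar) - c\<^sup>2 * (norm g)\<^sup>2 / 2" .
  moreover have "(norm (w - c *\<^sub>R g - ustar))\<^sup>2
      = (norm (w - ustar))\<^sup>2 - 2 * c * (g \<bullet> (w - ustar)) + c\<^sup>2 * (norm g)\<^sup>2"
    unfolding power2_norm_eq_inner
    by (simp add: inner_diff_left inner_diff_right inner_commute power2_eq_square algebra_simps)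
  ultimately show ?thesis
    unfolding potential_def potential_bound_def g_def[symmetric] l_def[symmetric] c_def[symmetric]
    by linarith
qed

text \<open>
  The weights \<open>p\<close> cancel against the factors \<open>1 / p\<close> in the linear terms, which therefore sum to
  the full gradient in the direction \<open>a *\<^sub>R (w - ustar)\<close>. The choice of \<open>y\<close> splits this direction
  into directions from \<open>y\<close> to \<open>ustar\<close> and to \<open>x\<close>, where convexity applies.
\<close>

lemma mean_potential_bound_le:
  assumes us: "f ustar = fstar"
    and T: "0 < T" "0 < a" and M: "M = rate C0 C1 \<Delta>" "0 < M" and \<Delta>: "0 < \<Delta>"
    and y: "y = (1 / (T + a)) *\<^sub>R (T *\<^sub>R x + a *\<^sub>R w)"
  shows "(\<Sum>B\<in>\<B>. block_rate \<Delta> B / M *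
            potential_bound T a (block_rate \<Delta> B / M) ustar B y w)
         \<le> potential T ustar x w"
proof -
  define p where "p = (\<lambda>B. block_rate \<Delta> B / M)"
  define G where "G = (T + a) * (f y - fstar) + (norm (w - ustar))\<^sup>2 / 2"
  have p1: "(\<Sum>B\<in>\<B>. p B) = 1"
    using M sum_block_rate[of \<Delta>] by (simp add: p_def sum_divide_distrib[symmetric])
  have each: "p B * potential_bound T a (p B) ustar B y w
      = p B * G - a * (block_part B (gradient f y) \<bullet> (w - ustar))" if B: "B \<in> \<B>" for B
  proof (cases "p B = 0")
    case True
    then have "sqrt (\<kappa> B) + sqrt (5 * \<nu> B * \<Delta>) = 0" using M by (simp add: p_def block_rate_def)
    then have "sqrt (\<kappa> B) = 0 \<and> sqrt (5 * \<nu> B * \<Delta>) = 0"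
      using \<kappa>_nonneg[OF B] \<nu>_nonneg[OF B] \<Delta> by (subst (asm) add_nonneg_eq_0_iff) auto
    then have "block_gradient B f y = 0"
      using \<Delta> by (intro block_gradient_eq_0[OF B]) auto
    then show ?thesis using True by (simp add: block_gradient_eq)
  next
    case False
    then show ?thesis
      by (simp add: potential_bound_def G_def block_gradient_eq algebra_simps)
  qed
  have "(\<Sum>B\<in>\<B>. p B * potential_bound T a (p B) ustar B y w)
      = (\<Sum>B\<in>\<B>. p B) * G - a * ((\<Sum>B\<in>\<B>. block_part B (gradient f y)) \<bullet> (w - ustar))"
    by (simp add: each sum_subtractf sum_distrib_left sum_distrib_right inner_sum_left)
  also have "\<dots> = G - gradient f y \<bullet> (a *\<^sub>R (w - ustar))"
    by (simp add: p1 sum_block_part[OF partition])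
  also have "a *\<^sub>R (w - ustar) = - (a *\<^sub>R (ustar - y) + T *\<^sub>R (x - y))"
  proof -
    have "(T + a) *\<^sub>R y = T *\<^sub>R x + a *\<^sub>R w" using T by (simp add: y)
    then show ?thesis by (simp add: algebra_simps)
  qed
  also have "G - gradient f y \<bullet> - (a *\<^sub>R (ustar - y) + T *\<^sub>R (x - y))
      = G + a * (gradient f y \<bullet> (ustar - y)) + T * (gradient f y \<bullet> (x - y))"
    by (simp add: inner_add_right inner_diff_right algebra_simps)
  also have "\<dots> \<le> G + a * (fstar - f y) + T * (f x - f y)"
    using T convex_gradient_inequality[OF convex C2, of y ustar]
      convex_gradient_inequality[OF convex C2, of y x]
    by (intro add_mono mult_left_mono) (auto simp: us)
  also have "\<dots> = potential T ustar x w"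
    by (simp add: G_def potential_def algebra_simps)
  finally show ?thesis by (simp add: p_def)
qed

end

section \<open>The step sizes and the number of steps\<close>

lemma step_weight_works:
  assumes M: "0 < M" and T: "0 \<le> T"
  shows "0 < step_weight M T" "M\<^sup>2 * (step_weight M T)\<^sup>2 = T + step_weight M T"
proof -
  define q where "q = sqrt (1 + 4 * M\<^sup>2 * T)"
  define a0 where "a0 = (1 + q) / (2 * M\<^sup>2)"
  have q: "0 \<le> q" "q\<^sup>2 = 1 + 4 * M\<^sup>2 * T" using T by (simp_all add: q_def)
  define \<mu> where "\<mu> = M\<^sup>2"
  have \<mu>: "0 < \<mu>" using M by (simp add: \<mu>_def)
  have a0: "0 < a0" using q M by (auto simp: a0_def intro!: divide_pos_pos)
  have "\<mu> * a0\<^sup>2 = (1 + 2 * q + q\<^sup>2) / (4 * \<mu>)"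
    using \<mu> unfolding a0_def \<mu>_def[symmetric]
    by (simp add: power_divide power_mult_distrib power2_sum) (simp add: field_simps power2_eq_square)
  also have "\<dots> = T + a0"
    using \<mu> unfolding a0_def \<mu>_def[symmetric] q(2) by (simp add: field_simps)
  finally have eq: "M\<^sup>2 * a0\<^sup>2 = T + a0" by (simp add: \<mu>_def)
  have uniq: "a = b" if a: "0 < a" "M\<^sup>2 * a\<^sup>2 = T + a" and b: "0 < b" "M\<^sup>2 * b\<^sup>2 = T + b" for a b :: real
  proof -
    have "1 \<le> M\<^sup>2 * a"
    proof -
      have "a * 1 \<le> a * (M\<^sup>2 * a)" using a T by (simp add: power2_eq_square algebra_simps)
      then show ?thesis using a(1) by (subst (asm) mult_le_cancel_left_pos) auto
    qed
    moreover have "0 < M\<^sup>2 * b" using M b by simp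
    ultimately have "M\<^sup>2 * a + M\<^sup>2 * b - 1 \<noteq> 0" by linarith
    moreover have "(a - b) * (M\<^sup>2 * a + M\<^sup>2 * b - 1) = 0"
      using a(2) b(2) by (simp add: power2_eq_square algebra_simps)
    ultimately show ?thesis by simp
  qed
  have "\<exists>!a. 0 < a \<and> M\<^sup>2 * a\<^sup>2 = T + a" using a0 eq uniq by blast
  from theI'[OF this]
  show "0 < step_weight M T" "M\<^sup>2 * (step_weight M T)\<^sup>2 = T + step_weight M T"
    by (simp_all add: step_weight_def)
qed

text \<open>
  Since \<open>sqrt (t + a) = m * a\<close>, completing the square in \<open>m\<^sup>2 * a\<^sup>2 - a = t\<close> gives the increment.
\<close>

lemma sqrt_step_growth:
  fixes m t a :: real
  assumes m: "0 < m" and t: "0 < t" and a: "0 < a" and eq: "m\<^sup>2 * a\<^sup>2 = t + a"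
  shows "sqrt t + 1 / (2 * m) \<le> sqrt (t + a)"
proof -
  have root: "sqrt (t + a) = m * a"
    using m a by (intro real_sqrt_unique) (simp_all add: power_mult_distrib eq)
  have "m * a * (m * a - 1 / m) = m\<^sup>2 * a\<^sup>2 - a"
    using m by (simp add: right_diff_distrib power2_eq_square)
  then have "0 < m * a * (m * a - 1 / m)" using t eq by linarith
  then have "0 < m * a - 1 / m" using m a by (metis mult_pos_pos zero_less_mult_pos)
  moreover have "1 / (2 * m) \<le> 1 / m" using m by (simp add: field_simps)
  ultimately have nonneg: "0 \<le> m * a - 1 / (2 * m)" by linarith
  have "(m * a - 1 / (2 * m))\<^sup>2 = m\<^sup>2 * a\<^sup>2 - a + (1 / (2 * m))\<^sup>2"
    using m by (simp add: power2_diff power_mult_distrib)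
  then have "t \<le> (m * a - 1 / (2 * m))\<^sup>2"
    using eq zero_le_power2[of "1 / (2 * m)"] by linarith
  then have "sqrt t \<le> m * a - 1 / (2 * m)"
    using nonneg by (intro real_le_lsqrt)
  then show ?thesis unfolding root by simp
qed

locale step_schedule =
  fixes c0 c1 D \<rho> d :: real
  assumes c0: "0 < c0" and c1: "0 \<le> c1" and D: "0 < D" and \<rho>: "0 < \<rho>" and d: "0 < d"
begin

abbreviation "T \<equiv> T_seq c0 c1 D \<rho> d"
abbreviation "gap k \<equiv> budget \<rho> d / T k"
abbreviation "M k \<equiv> rate c0 c1 (gap k)"
abbreviation "a k \<equiv> step_weight (M k) (T k)"

lemma budget_pos: "0 < budget \<rho> d" using \<rho> d by (simp add: budget_def)

lemma rate_pos: "0 \<le> \<Delta> \<Longrightarrow> 0 < rate c0 c1 \<Delta>"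
  using c0 c1 by (simp add: rate_def add_pos_nonneg)

lemma T_pos: "0 < T k"
proof (induction k)
  case 0
  then show ?case using \<rho> D by simp
next
  case (Suc k)
  then show ?case
    using step_weight_works(1)[OF rate_pos, of "gap k" "T k"] budget_pos
    by (simp add: Let_def add_pos_pos)
qed

lemma M_pos: "0 < M k" using rate_pos T_pos[of k] budget_pos by simp

lemma a_pos: "0 < a k" and a_eq: "(M k)\<^sup>2 * (a k)\<^sup>2 = T k + a k"
  using step_weight_works[OF M_pos less_imp_le[OF T_pos]] by auto

lemma T_Suc: "T (Suc k) = T k + a k" by (simp add: Let_def)

text \<open>
  The part of \<open>M k * sqrt (T k)\<close> that comes from \<open>c1\<close>; it does not depend on \<open>k\<close>.
\<close>

definition "K = sqrt 5 * \<rho> * c1 / sqrt d"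

lemma K_nonneg: "0 \<le> K" using \<rho> c1 d by (simp add: K_def)

lemma M_sqrt_T: "M k * sqrt (T k) = c0 * sqrt (T k) + K"
proof -
  have "sqrt (5 * gap k) * sqrt (T k) = sqrt (5 * budget \<rho> d)"
    using T_pos[of k] by (simp flip: real_sqrt_mult)
  also have "\<dots> = sqrt 5 * \<rho> / sqrt d"
    using \<rho> by (simp add: budget_def real_sqrt_mult real_sqrt_divide)
  finally show ?thesis by (simp add: rate_def K_def algebra_simps)
qed

lemma sqrt_T_growth: "sqrt (T k) + 1 / (2 * M k) \<le> sqrt (T (Suc k))"
  unfolding T_Suc by (rule sqrt_step_growth[OF M_pos T_pos a_pos a_eq])

text \<open>
  The linear term measures the progress where \<open>c0 * sqrt T\<close> dominates and the logarithm that
  where \<open>K\<close> dominates. The coefficient is \<open>K + 1\<close>, not \<open>K\<close>, because the increment of \<open>sqrt T\<close>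
  may be much larger than \<open>sqrt T\<close> when \<open>c0 * sqrt T + K\<close> is small, and the logarithm
  alone, weighted by \<open>K\<close>, can then gain too little.
\<close>

definition "\<Phi> k = c0 * sqrt (T k) + (K + 1) * ln (sqrt (T k))"

lemma \<Phi>_growth: "\<Phi> k + 1 / 2 \<le> \<Phi> (Suc k)"
proof -
  define s s' where "s = sqrt (T k)" and "s' = sqrt (T (Suc k))"
  define w where "w = c0 * s + K"
  have s: "0 < s" "0 < s'" using T_pos[of k] T_pos[of "Suc k"] by (auto simp: s_def s'_def simp del: T_seq.simps)
  have w: "0 < w" using c0 s K_nonneg by (simp add: w_def add_pos_nonneg)
  have "M k * s = w" using M_sqrt_T by (simp add: s_def w_def)
  then have "M k = w / s" using s by (simp add: field_simps)
  then have "s + s / (2 * w) \<le> s'"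
    using sqrt_T_growth[of k] by (simp add: s_def[symmetric] s'_def[symmetric] del: T_seq.simps)
  then have grow: "s * (1 + 1 / (2 * w)) \<le> s'" by (simp add: algebra_simps)
  have "c0 * s / (2 * w + 1) \<le> c0 * s / (2 * w)"
    using w s c0 by (intro divide_left_mono) auto
  also have "\<dots> = c0 * (s * (1 + 1 / (2 * w)) - s)" by (simp add: algebra_simps)
  also have "\<dots> \<le> c0 * (s' - s)" using grow c0 by (intro mult_left_mono) auto
  finally have lin: "c0 * s / (2 * w + 1) \<le> c0 * (s' - s)" .
  \<comment> \<open>The inequality ln (1 + x) >= x / (1 + x) at x = 1 / (2 w).\<close>
  have "ln (2 * w / (2 * w + 1)) \<le> 2 * w / (2 * w + 1) - 1"
    using w by (intro ln_le_minus_one) auto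
  also have "\<dots> = - (1 / (2 * w + 1))" using w by (simp add: field_simps)
  finally have "1 / (2 * w + 1) \<le> - ln (2 * w / (2 * w + 1))" by simp
  also have "\<dots> = ln (inverse (2 * w / (2 * w + 1)))" using w by (subst ln_inverse) auto
  also have "inverse (2 * w / (2 * w + 1)) = 1 + 1 / (2 * w)" using w by (simp add: field_simps)
  also have "ln (1 + 1 / (2 * w)) = ln (s * (1 + 1 / (2 * w))) - ln s"
    using s w by (subst ln_mult_pos) (auto intro!: add_pos_pos)
  also have "\<dots> \<le> ln s' - ln s"
    using grow s w by (intro diff_right_mono) (subst ln_le_cancel_iff, auto intro!: mult_pos_pos add_pos_pos)
  finally have "(K + 1) * (1 / (2 * w + 1)) \<le> (K + 1) * (ln s' - ln s)"
    using K_nonneg by (intro mult_left_mono) auto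
  with lin have "c0 * s / (2 * w + 1) + (K + 1) / (2 * w + 1) \<le> \<Phi> (Suc k) - \<Phi> k"
    by (simp add: \<Phi>_def s_def[symmetric] s'_def[symmetric] algebra_simps del: T_seq.simps)
  moreover have "1 / 2 \<le> (w + 1) / (2 * w + 1)" using w by (simp add: field_simps)
  then have "1 / 2 \<le> c0 * s / (2 * w + 1) + (K + 1) / (2 * w + 1)"
    by (simp add: w_def add_divide_distrib[symmetric] algebra_simps)
  ultimately show ?thesis by linarith
qed

lemma \<Phi>_lower: "\<Phi> 0 + real k / 2 \<le> \<Phi> k"
proof (induction k)
  case (Suc k)
  then show ?case using \<Phi>_growth[of k] by (simp add: add_divide_distrib)
qed simp

lemma unfinished_steps_le:
  assumes d1: "d < 1" and e: "0 < e" "e < D"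
    and unfinished: "\<And>k. k < n \<Longrightarrow> T k < budget \<rho> d / e"
  shows "real n \<le> 3 * log_factor [\<rho>, c0, c1, D, d, e]
             * (1 + \<rho> * c0 / sqrt (d * e) + \<rho> * c1 / sqrt d)"
proof -
  define L where "L = log_factor [\<rho>, c0, c1, D, d, e]"
  define X where "X = \<rho> * c0 / sqrt (d * e)"
  define Y where "Y = \<rho> * c1 / sqrt d"
  have XY: "0 \<le> X" "0 \<le> Y" using \<rho> c0 c1 d e by (auto simp: X_def Y_def)
  have L: "1 \<le> L" "1 + \<bar>ln D\<bar> + \<bar>ln d\<bar> + \<bar>ln e\<bar> \<le> L"
    by (auto simp: L_def log_factor_def)
  have "real n \<le> 1 + 2 * X + (3 * Y + 1) * L"
  proof (cases n)
    case 0
    then show ?thesis using XY L by (simp add: add_nonneg_nonneg)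
  next
    case (Suc m)
    have "T m < budget \<rho> d / e" using unfinished Suc by simp
    have "sqrt (T m) \<le> sqrt (budget \<rho> d / e)" using \<open>T m < _\<close> by simp
    also have "\<dots> = \<rho> / sqrt (d * e)"
      using \<rho> by (simp add: budget_def real_sqrt_divide)
    finally have "c0 * sqrt (T m) \<le> X"
      using mult_left_mono[of _ _ c0] c0 by (fastforce simp: X_def mult.commute)
    moreover have "0 \<le> c0 * sqrt (T 0)" using c0 T_pos[of 0] by (simp del: T_seq.simps)
    ultimately have A: "c0 * sqrt (T m) - c0 * sqrt (T 0) \<le> X" by linarith
    have "ln (T m) \<le> ln (budget \<rho> d / e)"
      using \<open>T m < _\<close> T_pos[of m] by (simp add: order_less_imp_le)
    moreover have "ln (budget \<rho> d / e) - ln (T 0) = ln 2 + ln D - ln d - ln e"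
      using \<rho> d e D by (simp add: budget_def ln_div ln_mult)
    moreover have "ln 2 \<le> (1::real)" using ln_2_less_1 by simp
    ultimately have "ln (T m) - ln (T 0) \<le> L" using L by linarith
    then have "2 * (ln (sqrt (T m)) - ln (sqrt (T 0))) \<le> L"
      using T_pos[of m] T_pos[of 0] by (simp add: ln_sqrt del: T_seq.simps)
    then have "(K + 1) * (2 * (ln (sqrt (T m)) - ln (sqrt (T 0)))) \<le> (K + 1) * L"
      using K_nonneg by (intro mult_left_mono) auto
    also have "\<dots> \<le> (3 * Y + 1) * L"
    proof -
      have "sqrt 5 \<le> (3::real)" by (intro real_le_lsqrt) auto
      then have "K \<le> 3 * Y"
        using XY(2) mult_right_mono[of "sqrt 5" 3 Y] by (simp add: K_def Y_def mult.assoc)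
      then show ?thesis using L by (intro mult_right_mono) auto
    qed
    finally have "2 * (\<Phi> m - \<Phi> 0) \<le> 2 * X + (3 * Y + 1) * L"
      using A by (simp add: \<Phi>_def algebra_simps del: T_seq.simps)
    then show ?thesis using \<Phi>_lower[of m] Suc by simp
  qed
  also have "\<dots> \<le> 3 * L * (1 + X + Y)"
    using mult_right_mono[OF L(1) XY(1)] L XY by (simp add: algebra_simps)
  finally show ?thesis by (simp add: L_def X_def Y_def)
qed

text \<open>
  The bound on the number of unfinished steps is uniform, so it also gives termination.
\<close>

lemma schedule_finishes:
  assumes "d < 1" "0 < e" "e < D"
  shows "\<exists>k. budget \<rho> d / e \<le> T k"
proof (rule ccontr)
  assume "\<not> ?thesis"
  then have "real n \<le> 3 * log_factor [\<rho>, c0, c1, D, d, e]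
             * (1 + \<rho> * c0 / sqrt (d * e) + \<rho> * c1 / sqrt d)" for n
    using unfinished_steps_le[OF assms] by (simp add: not_le)
  then show False using reals_Archimedean2 by (meson not_less)
qed

lemma stop_index_le:
  assumes "d < 1" "0 < e" "e < D"
  shows "real (stop_index c0 c1 D \<rho> d e) \<le> 3 * log_factor [\<rho>, c0, c1, D, d, e]
             * (1 + \<rho> * c0 / sqrt (d * e) + \<rho> * c1 / sqrt d)"
  by (rule unfinished_steps_le[OF assms])
    (auto simp: stop_index_def dest!: not_less_Least)

end

lemma stop_index_radius_0: "stop_index c0 c1 D 0 d e = 0"
  by (auto simp: stop_index_def budget_def intro!: Least_eq_0)

section \<open>The random choice of the block\<close>

lemma pmf_block_dist:
  fixes \<B> :: "('m::finite) set set"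
  assumes w: "\<And>B. B \<in> \<B> \<Longrightarrow> 0 \<le> w B" and pos: "0 < (\<Sum>B\<in>\<B>. sqrt (w B))"
  shows "pmf (block_dist \<B> w) B = (if B \<in> \<B> then sqrt (w B) / (\<Sum>B'\<in>\<B>. sqrt (w B')) else 0)"
  unfolding block_dist_def
proof (rule pmf_embed_pmf)
  let ?S = "\<Sum>B'\<in>\<B>. sqrt (w B')"
  let ?g = "\<lambda>B. if B \<in> \<B> then sqrt (w B) / ?S else 0"
  show nonneg: "0 \<le> ?g B" for B using w pos by simp
  have "(\<Sum>B\<in>UNIV. ?g B) = (\<Sum>B\<in>\<B>. sqrt (w B) / ?S)"
    by (simp add: sum.If_cases)
  also have "\<dots> = 1" using pos by (simp add: sum_divide_distrib[symmetric])
  finally have "(\<Sum>B\<in>UNIV. ?g B) = 1" .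
  moreover have "(\<integral>\<^sup>+ B. ennreal (?g B) \<partial>count_space UNIV) = (\<Sum>B\<in>UNIV. ennreal (?g B))"
    by (rule nn_integral_count_space_finite) simp
  moreover have "(\<Sum>B\<in>UNIV. ennreal (?g B)) = ennreal (\<Sum>B\<in>UNIV. ?g B)"
    using nonneg by (intro sum_ennreal)
  ultimately show "(\<integral>\<^sup>+ B. ennreal (?g B) \<partial>count_space UNIV) = 1" by simp
qed

context block_smooth
begin

lemma pmf_block_law:
  assumes C0: "0 < C0" and \<Delta>: "0 \<le> \<Delta>"
  shows "pmf (block_law \<B> \<kappa> \<nu> C0 (rate C0 C1 \<Delta>)) B
    = (if B \<in> \<B> then block_rate \<Delta> B / rate C0 C1 \<Delta> else 0)"
proof -
  define M where "M = rate C0 C1 \<Delta>"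
  have M: "C0 \<le> M" "0 < M" using C0 C1_nonneg \<Delta> by (simp_all add: M_def rate_def add_pos_nonneg)
  have k: "pmf (block_dist \<B> \<kappa>) B = (if B \<in> \<B> then sqrt (\<kappa> B) / C0 else 0)"
    using C0 \<kappa>_nonneg by (subst pmf_block_dist) (auto simp: C0_def)
  have n: "(1 - C0 / M) * pmf (block_dist \<B> \<nu>) B
      = (if B \<in> \<B> then sqrt (5 * \<nu> B * \<Delta>) / M else 0)"
  proof (cases "C1 = 0")
    case True
    then have "\<nu> B = 0" if "B \<in> \<B>"
      using that \<nu>_nonneg sum_nonneg_eq_0_iff[OF finite_\<B>, of "\<lambda>B. sqrt (\<nu> B)"]
      by (auto simp: C1_def)
    moreover have "M = C0" using True by (simp add: M_def rate_def)
    ultimately show ?thesis using C0 by simp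
  next
    case False
    then have C1: "0 < C1" using C1_nonneg by simp
    have "1 - C0 / M = sqrt (5 * \<Delta>) * C1 / M"
      using M by (simp add: M_def rate_def field_simps)
    moreover have "pmf (block_dist \<B> \<nu>) B = (if B \<in> \<B> then sqrt (\<nu> B) / C1 else 0)"
      using C1 \<nu>_nonneg by (subst pmf_block_dist) (auto simp: C1_def)
    ultimately show ?thesis
      using C1 by (simp add: real_sqrt_mult)
  qed
  have "pmf (block_law \<B> \<kappa> \<nu> C0 M) B
      = C0 / M * pmf (block_dist \<B> \<kappa>) B + (1 - C0 / M) * pmf (block_dist \<B> \<nu>) B"
    using M C0 by (simp add: block_law_def pmf_bind)
  also have "\<dots> = (if B \<in> \<B> then block_rate \<Delta> B / M else 0)"
    using C0 by (simp add: k n block_rate_def add_divide_distrib)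
  finally show ?thesis by (simp add: M_def)
qed

end

text \<open>
  An event of constant conditional probability factors out of integrals of functions measurable
  with respect to the past. Working with nonnegative integrals spares all integrability questions for
  the iterates, which need not be bounded.
\<close>

lemma nn_integral_indicator_cond_prob:
  assumes "prob_space P" and F: "subalgebra P F" and E: "E \<in> sets P"
    and p: "0 \<le> p" "AE \<omega> in P. real_cond_exp P F (indicator E) \<omega> = p"
    and G: "G \<in> borel_measurable F"
  shows "(\<integral>\<^sup>+\<omega>. G \<omega> * indicator E \<omega> \<partial>P) = ennreal p * (\<integral>\<^sup>+\<omega>. G \<omega> \<partial>P)"
proof -
  interpret prob_space P by fact
  interpret finite_measure_subalgebra P F
    by unfold_locales (rule F)
  have "(\<integral>\<^sup>+\<omega>\<in>A. indicator E \<omega> \<partial>P) = (\<integral>\<^sup>+\<omega>\<in>A. ennreal p \<partial>P)" if A: "A \<in> sets F" for A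
  proof -
    have A': "A \<in> sets P" using A F by (auto simp: subalgebra_def)
    have int: "integrable P (indicator E :: _ \<Rightarrow> real)"
      using E by (intro integrable_real_indicator) (auto simp: emeasure_eq_measure)
    have "measure P (E \<inter> A) = (\<integral>\<omega>\<in>A. indicator E \<omega> \<partial>P)"
      using E A' by (simp add: set_lebesgue_integral_def indicator_inter_arith[symmetric] Int_commute)
    also have "\<dots> = (\<integral>\<omega>\<in>A. real_cond_exp P F (indicator E) \<omega> \<partial>P)"
      by (rule real_cond_exp_intA[OF int A])
    also have "\<dots> = (\<integral>\<omega>\<in>A. p \<partial>P)"
      unfolding set_lebesgue_integral_def
      using p(2) A' by (intro integral_cong_AE) (auto intro!: borel_measurable_cond_exp2)
    also have "\<dots> = p * measure P A"
      using A' by (simp add: set_lebesgue_integral_def)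
    finally have "emeasure P (E \<inter> A) = ennreal p * emeasure P A"
      using p(1) by (simp add: emeasure_eq_measure ennreal_mult)
    moreover have "(\<integral>\<^sup>+\<omega>\<in>A. indicator E \<omega> \<partial>P) = emeasure P (E \<inter> A)"
      using E A' by (simp add: indicator_inter_arith[symmetric])
    moreover have "(\<integral>\<^sup>+\<omega>\<in>A. ennreal p \<partial>P) = ennreal p * emeasure P A"
      using A' by (simp add: nn_integral_cmult_indicator)
    ultimately show ?thesis by simp
  qed
  then have AE: "AE \<omega> in P. ennreal p = nn_cond_exp P F (indicator E) \<omega>"
    using E by (intro nn_cond_exp_charact) auto
  have "(\<integral>\<^sup>+\<omega>. G \<omega> * indicator E \<omega> \<partial>P) = (\<integral>\<^sup>+\<omega>. G \<omega> * nn_cond_exp P F (indicator E) \<omega> \<partial>P)"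
    using E by (intro nn_cond_exp_intg[symmetric] G) auto
  also have "\<dots> = (\<integral>\<^sup>+\<omega>. ennreal p * G \<omega> \<partial>P)"
    using AE by (intro nn_integral_cong_AE) (auto simp: mult.commute)
  also have "\<dots> = ennreal p * (\<integral>\<^sup>+\<omega>. G \<omega> \<partial>P)"
    using measurable_from_subalg[OF F G] by (rule nn_integral_cmult)
  finally show ?thesis .
qed

context block_smooth
begin

lemma continuous_objective: "continuous_on UNIV f"
  using C2 by (auto simp: C2_function_def continuous_on_eq_continuous_at differentiable_imp_continuous_within)

lemma continuous_block_gradient: "continuous_on UNIV (block_gradient B f)"
proof -
  have "continuous_on UNIV (gradient f)"
    using C2 by (auto simp: C2_function_def continuous_on_eq_continuous_at differentiable_imp_continuous_within)
  then have "continuous_on UNIV (\<lambda>x. if i \<in> B then gradient f x $ i else 0)" for i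
    by (cases "i \<in> B") (auto intro!: continuous_intros)
  then show ?thesis
    unfolding block_gradient_def by (intro continuous_on_vec_lambda)
qed

lemma measurable_objective [measurable]: "f \<in> borel_measurable borel"
  by (rule borel_measurable_continuous_onI[OF continuous_objective])

lemma measurable_block_gradient [measurable]: "block_gradient B f \<in> borel_measurable borel"
  by (rule borel_measurable_continuous_onI[OF continuous_block_gradient])

lemma measurable_potential:
  assumes "x \<in> borel_measurable F" "w \<in> borel_measurable F"
  shows "(\<lambda>\<omega>. potential T ustar (x \<omega>) (w \<omega>)) \<in> borel_measurable F"
  using assms unfolding potential_def by measurable

text \<open>
  The new iterates are controlled by \<open>potential_bound\<close> of the drawn block, and for each fixed block this
  is a function of the past. So the sum over the blocks can be averaged whatever the rule by
  which \<open>x'\<close> is selected. On \<open>A\<close> each of these functions is nonnegative, because it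
  bounds the potential that the plain gradient step in that block would produce.
\<close>

lemma expected_potential_step:
  assumes "prob_space P" and F: "subalgebra P F"
    and xw[measurable]: "x \<in> borel_measurable F" "w \<in> borel_measurable F"
    and Bk: "Bk \<in> measurable P (count_space UNIV)"
    and law: "\<And>B. AE \<omega> in P. real_cond_exp P F (indicator {\<omega> \<in> space P. Bk \<omega> = B}) \<omega>
        = pmf (block_law \<B> \<kappa> \<nu> C0 M) B"
    and step: "AE \<omega> in P. accel_step f \<kappa> \<nu> M \<Delta> T (Bk \<omega>) (x \<omega>) (w \<omega>) (x' \<omega>) (w' \<omega>)"
    and us: "f ustar = fstar" and C0: "0 < C0" and T: "0 < T" and pi: "0 < \<pi>"
    and \<Delta>: "\<Delta> = \<pi> / T" and M: "M = rate C0 C1 \<Delta>"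
    and A: "A \<in> sets F" and bounded: "\<And>\<omega>. \<omega> \<in> A \<Longrightarrow> potential T ustar (x \<omega>) (w \<omega>) \<le> \<pi>"
  shows "(\<integral>\<^sup>+\<omega>\<in>A. ennreal (potential (T + step_weight M T) ustar (x' \<omega>) (w' \<omega>)) \<partial>P)
       \<le> (\<integral>\<^sup>+\<omega>\<in>A. ennreal (potential T ustar (x \<omega>) (w \<omega>)) \<partial>P)"
proof -
  interpret prob_space P by fact
  define a where "a = step_weight M T"
  define y where "y = (\<lambda>\<omega>. (1 / (T + a)) *\<^sub>R (T *\<^sub>R x \<omega> + a *\<^sub>R w \<omega>))"
  define p where "p = (\<lambda>B. if B \<in> \<B> then block_rate \<Delta> B / M else 0)"
  define Q where "Q = (\<lambda>B \<omega>. potential_bound T a (p B) ustar B (y \<omega>) (w \<omega>))"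
  define Ev where "Ev = (\<lambda>B. {\<omega> \<in> space P. Bk \<omega> = B})"
  have \<Delta>0: "0 < \<Delta>" using pi T by (simp add: \<Delta>)
  have M0: "0 < M" using C0 C1_nonneg \<Delta>0 by (simp add: M rate_def add_pos_nonneg)
  have a: "0 < a" "M\<^sup>2 * a\<^sup>2 = T + a"
    using step_weight_works[OF M0, of T] T by (simp_all add: a_def)
  have p0: "0 \<le> p B" for B
    using block_rate_nonneg[of B \<Delta>] \<Delta>0 M0 by (simp add: p_def)
  have pmf: "pmf (block_law \<B> \<kappa> \<nu> C0 M) B = p B" for B
    using pmf_block_law[OF C0, of \<Delta>] \<Delta>0 by (simp add: M p_def)
  have Ev[measurable]: "Ev B \<in> sets P" for B
    using measurable_sets[OF Bk, of "{B}"] by (simp add: Ev_def vimage_def Int_def conj_commute)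
  have split: "(\<integral>\<^sup>+\<omega>. G \<omega> * indicator (Ev B) \<omega> \<partial>P) = ennreal (p B) * (\<integral>\<^sup>+\<omega>. G \<omega> \<partial>P)"
    if "G \<in> borel_measurable F" for G B
    using law[of B] by (intro nn_integral_indicator_cond_prob[OF \<open>prob_space P\<close> F Ev p0 _ that])
      (simp add: Ev_def pmf)
  have Qm[measurable]: "Q B \<in> borel_measurable F" for B
    unfolding Q_def potential_bound_def y_def by measurable
  define H where "H = (\<lambda>B \<omega>. ennreal (Q B \<omega>) * indicator A \<omega>)"
  have HF: "H B \<in> borel_measurable F" for B
    unfolding H_def using A by measurable
  have HP: "H B \<in> borel_measurable P" for B
    by (rule measurable_from_subalg[OF F HF])
  have gap: "f (y \<omega>) - fstar \<le> 5 * \<Delta>" if "\<omega> \<in> A" for \<omega>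
  proof -
    have "f (y \<omega>) - fstar \<le> 4 * (\<pi> / (T + a))"
      using bounded[OF that] M a by (intro coupling_point_gap[OF us T _ pi]) (auto simp: \<Delta> y_def potential_def)
    also have "\<dots> \<le> 5 * \<Delta>"
      unfolding \<Delta> using T a pi by (intro mult_mono divide_left_mono) auto
    finally show ?thesis .
  qed
  have step_le: "potential (T + a) ustar x'' (w \<omega> - (a / p B) *\<^sub>R block_gradient B f (y \<omega>)) \<le> Q B \<omega>"
    if "\<omega> \<in> A" "0 < p B"
      "f x'' \<le> f (y \<omega> - (1 / (block_rate \<Delta> B)\<^sup>2) *\<^sub>R block_gradient B f (y \<omega>))" for \<omega> B x''
  proof -
    have B: "B \<in> \<B>" "p B = block_rate \<Delta> B / M" using that(2) by (auto simp: p_def split: if_splits)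
    then have "0 < block_rate \<Delta> B" using that(2) M0 by (simp add: zero_less_divide_iff)
    then show ?thesis
      unfolding Q_def B(2)
      using B(1) T a M0 \<Delta>0 gap[OF that(1)] that(3) by (intro potential_step) auto
  qed
  have Q0: "0 \<le> Q B \<omega>" if "\<omega> \<in> A" "0 < p B" for \<omega> B
    using potential_nonneg[of "T + a"] T a order_trans[OF _ step_le[OF that order.refl]] by simp
  have drawn: "AE \<omega> in P. \<forall>B. Bk \<omega> = B \<longrightarrow> 0 < p B"
  proof -
    have "AE \<omega> in P. Bk \<omega> = B \<longrightarrow> 0 < p B" for B
    proof (cases "p B = 0")
      case True
      have "emeasure P (Ev B) = 0"
        using split[of "\<lambda>_. 1" B] True by simp
      then have "Ev B \<in> null_sets P" by auto
      from AE_not_in[OF this] AE_space show ?thesis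
        by eventually_elim (simp add: Ev_def)
    qed (use p0[of B] in \<open>auto simp: order_less_le\<close>)
    then have "AE \<omega> in P. \<forall>B\<in>UNIV. Bk \<omega> = B \<longrightarrow> 0 < p B"
      by (intro AE_finite_allI finite)
    then show ?thesis by simp
  qed
  have "(\<integral>\<^sup>+\<omega>\<in>A. ennreal (potential (T + a) ustar (x' \<omega>) (w' \<omega>)) \<partial>P)
      \<le> (\<integral>\<^sup>+\<omega>. (\<Sum>B\<in>UNIV. H B \<omega> * indicator (Ev B) \<omega>) \<partial>P)"
  proof (rule nn_integral_mono_AE)
    show "AE \<omega> in P. ennreal (potential (T + a) ustar (x' \<omega>) (w' \<omega>)) * indicator A \<omega>
        \<le> (\<Sum>B\<in>UNIV. H B \<omega> * indicator (Ev B) \<omega>)"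
      using step drawn AE_space
    proof eventually_elim
      case (elim \<omega>)
      define B where "B = Bk \<omega>"
      have pB: "0 < p B" using elim by (simp add: B_def)
      then have B: "B \<in> \<B>" "p B = block_rate \<Delta> B / M" by (auto simp: p_def split: if_splits)
      have "ennreal (potential (T + a) ustar (x' \<omega>) (w' \<omega>)) * indicator A \<omega> \<le> H B \<omega>"
      proof (cases "\<omega> \<in> A")
        case True
        have w': "w' \<omega> = w \<omega> - (a / p B) *\<^sub>R block_gradient B f (y \<omega>)"
          and x': "f (x' \<omega>) \<le> f (y \<omega> - (1 / (block_rate \<Delta> B)\<^sup>2) *\<^sub>R block_gradient B f (y \<omega>))"
          using elim(1) unfolding accel_step_def Let_def B(2)
          by (simp_all add: a_def y_def B_def block_rate_def)
        show ?thesis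
          using step_le[OF True pB x'] True by (simp add: H_def w' ennreal_leI)
      qed simp
      also have "\<dots> = H B \<omega> * indicator (Ev B) \<omega>"
        using elim by (simp add: Ev_def B_def)
      also have "\<dots> \<le> (\<Sum>B\<in>UNIV. H B \<omega> * indicator (Ev B) \<omega>)"
        by (rule member_le_sum) auto
      finally show ?case .
    qed
  qed
  also have "\<dots> = (\<Sum>B\<in>UNIV. \<integral>\<^sup>+\<omega>. H B \<omega> * indicator (Ev B) \<omega> \<partial>P)"
    using HP by (intro nn_integral_sum) auto
  also have "\<dots> = (\<Sum>B\<in>UNIV. \<integral>\<^sup>+\<omega>. ennreal (p B) * H B \<omega> \<partial>P)"
    using HP by (simp add: split[OF HF] nn_integral_cmult)
  also have "\<dots> = (\<integral>\<^sup>+\<omega>. (\<Sum>B\<in>UNIV. ennreal (p B) * H B \<omega>) \<partial>P)"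
    using HP by (intro nn_integral_sum[symmetric]) auto
  also have "\<dots> \<le> (\<integral>\<^sup>+\<omega>\<in>A. ennreal (potential T ustar (x \<omega>) (w \<omega>)) \<partial>P)"
  proof (rule nn_integral_mono)
    fix \<omega>
    show "(\<Sum>B\<in>UNIV. ennreal (p B) * H B \<omega>)
        \<le> ennreal (potential T ustar (x \<omega>) (w \<omega>)) * indicator A \<omega>"
    proof (cases "\<omega> \<in> A")
      case True
      have "ennreal (p B) * H B \<omega> = ennreal (p B * Q B \<omega>)" for B
        using True p0[of B] by (simp add: H_def ennreal_mult')
      moreover have nonneg: "0 \<le> p B * Q B \<omega>" for B
        using Q0[OF True, of B] p0[of B] by (cases "p B = 0") auto
      ultimately have "(\<Sum>B\<in>UNIV. ennreal (p B) * H B \<omega>) = ennreal (\<Sum>B\<in>UNIV. p B * Q B \<omega>)"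
        by (simp add: sum_ennreal)
      also have "(\<Sum>B\<in>UNIV. p B * Q B \<omega>) = (\<Sum>B\<in>\<B>. p B * Q B \<omega>)"
        by (intro sum.mono_neutral_right) (auto simp: p_def)
      also have "\<dots> = (\<Sum>B\<in>\<B>. block_rate \<Delta> B / M *
          potential_bound T a (block_rate \<Delta> B / M) ustar B (y \<omega>) (w \<omega>))"
        by (intro sum.cong) (auto simp: p_def Q_def)
      also have "\<dots> \<le> potential T ustar (x \<omega>) (w \<omega>)"
        by (rule mean_potential_bound_le[OF us T a(1) M M0 \<Delta>0]) (simp add: y_def)
      finally show ?thesis using True by (simp add: ennreal_leI)
    qed (simp add: H_def)
  qed
  finally show ?thesis by (simp add: a_def)
qed

section \<open>The probability of success\<close>

text \<open>
  The maximal inequality, proved directly. On \<open>A k\<close> the potential has stayed below \<open>\<pi>\<close> up to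
  step \<open>k\<close>. Freezing it at the value \<open>\<pi>\<close> once it exceeds \<open>\<pi>\<close> gives a process whose mean does
  not grow: an outcome leaving \<open>A k\<close> does so with a potential above \<open>\<pi>\<close>. This mean is at most
  \<open>r\<^sup>2 = \<delta> * \<pi>\<close>, and it is at least \<open>\<pi>\<close> times the probability of leaving.
\<close>

lemma run_success_probability:
  assumes "prob_space P" and run: "accel_run P Fil f \<B> \<kappa> \<nu> z D r \<delta> \<epsilon> u v Blk"
    and us: "f ustar = fstar" and C0: "0 < C0" and r: "0 < r" and D: "0 < D"
    and \<delta>: "0 < \<delta>" "\<delta> < 1" and \<epsilon>: "0 < \<epsilon>"
    and start: "f z - fstar \<le> D" "norm (z - ustar) \<le> r"
    and N: "N = stop_index C0 C1 D r \<delta> \<epsilon>"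
    and TN: "budget r \<delta> / \<epsilon> \<le> T_seq C0 C1 D r \<delta> N"
  shows "1 - \<delta> \<le> measure P {\<omega> \<in> space P. f (u N \<omega>) - fstar \<le> \<epsilon>}"
proof -
  interpret prob_space P by fact
  interpret step_schedule C0 C1 D r \<delta>
    using C0 C1_nonneg r D \<delta> by unfold_locales auto
  define \<pi> where "\<pi> = budget r \<delta>"
  have pi: "0 < \<pi>" using budget_pos by (simp add: \<pi>_def)
  have r2: "r\<^sup>2 = \<delta> * \<pi>" using \<delta> by (simp add: \<pi>_def budget_def)
  define E where "E = (\<lambda>k \<omega>. potential (T k) ustar (u k \<omega>) (v k \<omega>))"
  define A where "A = (\<lambda>k. {\<omega> \<in> space P. \<forall>j\<le>k. E j \<omega> \<le> \<pi>})"
  note run' = run[unfolded accel_run_def Let_def, folded C0_def C1_def, folded N]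
  have filt: "filtration (space P) Fil" and sub: "subalgebra P (Fil k)" for k
    using run' by auto
  have uv: "u k \<in> borel_measurable (Fil k)" "v k \<in> borel_measurable (Fil k)" if "k \<le> N" for k
    using run' that by auto
  have init: "u 0 \<omega> = z" "v 0 \<omega> = z" if "\<omega> \<in> space P" for \<omega>
    using run' that by auto
  have sF: "space (Fil k) = space P" for k using filtration.space_F[OF filt] .
  have EF: "E k \<in> borel_measurable (Fil k)" if "k \<le> N" for k
    unfolding E_def by (rule measurable_potential[OF uv[OF that]])
  have EP: "E k \<in> borel_measurable P" if "k \<le> N" for k
    by (rule measurable_from_subalg[OF sub EF[OF that]])
  have AF: "A k \<in> sets (Fil k)" if "k \<le> N" for k
  proof -
    have "{\<omega> \<in> space (Fil k). E j \<omega> \<le> \<pi>} \<in> sets (Fil k)" if j: "j \<le> k" for j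
    proof -
      have "{\<omega> \<in> space (Fil j). E j \<omega> \<le> \<pi>} \<in> sets (Fil j)"
      proof -
        have "E j \<in> borel_measurable (Fil j)" using EF[of j] j \<open>k \<le> N\<close> by simp
        then show ?thesis by measurable
      qed
      then show ?thesis using filtration.sets_F_mono[OF filt j] by (auto simp: sF)
    qed
    then have "(\<Inter>j\<in>{..k}. {\<omega> \<in> space (Fil k). E j \<omega> \<le> \<pi>}) \<in> sets (Fil k)"
      by (intro sets.finite_INT) auto
    moreover have "A k = (\<Inter>j\<in>{..k}. {\<omega> \<in> space (Fil k). E j \<omega> \<le> \<pi>})"
      by (auto simp: A_def sF)
    ultimately show ?thesis by simp
  qed
  have AP: "A k \<in> sets P" if "k \<le> N" for k
    using AF[OF that] sub[of k] by (auto simp: subalgebra_def)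
  have A_sub: "A (Suc k) \<subseteq> A k" for k by (auto simp: A_def)
  have step: "(\<integral>\<^sup>+\<omega>\<in>A k. ennreal (E (Suc k) \<omega>) \<partial>P) \<le> (\<integral>\<^sup>+\<omega>\<in>A k. ennreal (E k \<omega>) \<partial>P)"
    if k: "k < N" for k
  proof -
    have "Blk k \<in> measurable (Fil (Suc k)) (count_space UNIV)" using run' k by auto
    then have Bk: "Blk k \<in> measurable P (count_space UNIV)" by (rule measurable_from_subalg[OF sub])
    show ?thesis
      unfolding E_def T_Suc
    proof (rule expected_potential_step[OF \<open>prob_space P\<close> sub _ _ Bk])
      show "AE \<omega> in P. real_cond_exp P (Fil k) (indicator {\<omega> \<in> space P. Blk k \<omega> = B}) \<omega>
          = pmf (block_law \<B> \<kappa> \<nu> C0 (M k)) B" for B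
        using run' k by blast
      show "AE \<omega> in P. accel_step f \<kappa> \<nu> (M k) (gap k) (T k) (Blk k \<omega>)
          (u k \<omega>) (v k \<omega>) (u (Suc k) \<omega>) (v (Suc k) \<omega>)"
        using run' k by blast
      show "A k \<in> sets (Fil k)" using AF k by simp
      show "potential (T k) ustar (u k \<omega>) (v k \<omega>) \<le> \<pi>" if "\<omega> \<in> A k" for \<omega>
        using that by (auto simp: A_def E_def)
    qed (use uv k us C0 T_pos pi in \<open>auto simp: \<pi>_def\<close>)
  qed
  have main: "(\<integral>\<^sup>+\<omega>\<in>A k. ennreal (E k \<omega>) \<partial>P) + ennreal \<pi> * emeasure P (space P - A k)
      \<le> ennreal (r\<^sup>2)" if "k \<le> N" for k
    using that
  proof (induction k)
    case 0
    have E_init: "E 0 \<omega> \<le> r\<^sup>2" if "\<omega> \<in> space P" for \<omega>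
    proof -
      have "r\<^sup>2 / (2 * D) * (f z - fstar) \<le> r\<^sup>2 / (2 * D) * D"
        using start(1) D by (intro mult_left_mono) auto
      also have "\<dots> = r\<^sup>2 / 2" using D by simp
      finally have "r\<^sup>2 / (2 * D) * (f z - fstar) \<le> r\<^sup>2 / 2" .
      moreover have "(norm (z - ustar))\<^sup>2 \<le> r\<^sup>2" using start(2) by (intro power_mono) auto
      ultimately show ?thesis using init[OF that] by (simp add: E_def potential_def)
    qed
    have "r\<^sup>2 \<le> \<pi>" using r2 pi \<delta> by simp
    then have "A 0 = space P" using E_init by (force simp: A_def)
    moreover have "(\<integral>\<^sup>+\<omega>\<in>space P. ennreal (E 0 \<omega>) \<partial>P) \<le> (\<integral>\<^sup>+\<omega>. ennreal (r\<^sup>2) \<partial>P)"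
      using E_init by (intro nn_integral_mono) (auto intro: ennreal_leI)
    ultimately show ?case by (simp add: emeasure_space_1)
  next
    case (Suc k)
    have k: "k < N" "k \<le> N" using Suc by auto
    note [measurable] = AP[OF k(2)] AP[OF Suc(2)] EP[OF Suc(2)]
    have "space P - A (Suc k) = (space P - A k) \<union> (A k - A (Suc k))"
      using A_sub[of k] sets.sets_into_space[OF AP[OF k(2)]] by blast
    then have "emeasure P (space P - A (Suc k))
        = emeasure P (space P - A k) + emeasure P (A k - A (Suc k))"
      by (simp only:) (rule plus_emeasure[symmetric], auto)
    then have "(\<integral>\<^sup>+\<omega>\<in>A (Suc k). ennreal (E (Suc k) \<omega>) \<partial>P)
          + ennreal \<pi> * emeasure P (space P - A (Suc k))
        = ((\<integral>\<^sup>+\<omega>\<in>A (Suc k). ennreal (E (Suc k) \<omega>) \<partial>P)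
            + (\<integral>\<^sup>+\<omega>\<in>A k - A (Suc k). ennreal \<pi> \<partial>P)) + ennreal \<pi> * emeasure P (space P - A k)"
      by (simp add: nn_integral_cmult_indicator distrib_left ac_simps)
    also have "(\<integral>\<^sup>+\<omega>\<in>A (Suc k). ennreal (E (Suc k) \<omega>) \<partial>P)
            + (\<integral>\<^sup>+\<omega>\<in>A k - A (Suc k). ennreal \<pi> \<partial>P)
        = (\<integral>\<^sup>+\<omega>. ennreal (E (Suc k) \<omega>) * indicator (A (Suc k)) \<omega>
            + ennreal \<pi> * indicator (A k - A (Suc k)) \<omega> \<partial>P)"
      by (rule nn_integral_add[symmetric]) measurable
    also have "\<dots> \<le> (\<integral>\<^sup>+\<omega>\<in>A k. ennreal (E (Suc k) \<omega>) \<partial>P)"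
    proof (rule nn_integral_mono)
      fix \<omega> assume "\<omega> \<in> space P"
      have "\<pi> \<le> E (Suc k) \<omega>" if "\<omega> \<in> A k - A (Suc k)"
        using that by (auto simp: A_def le_Suc_eq)
      then show "ennreal (E (Suc k) \<omega>) * indicator (A (Suc k)) \<omega>
            + ennreal \<pi> * indicator (A k - A (Suc k)) \<omega>
          \<le> ennreal (E (Suc k) \<omega>) * indicator (A k) \<omega>"
        using A_sub[of k] by (auto simp: indicator_def intro: ennreal_leI)
    qed
    also have "\<dots> \<le> (\<integral>\<^sup>+\<omega>\<in>A k. ennreal (E k \<omega>) \<partial>P)" by (rule step[OF k(1)])
    also have "(\<integral>\<^sup>+\<omega>\<in>A k. ennreal (E k \<omega>) \<partial>P) + ennreal \<pi> * emeasure P (space P - A k)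
        \<le> ennreal (r\<^sup>2)"
      by (rule Suc.IH[OF k(2)])
    finally show ?case by (simp add: add_right_mono)
  qed
  have "ennreal \<pi> * emeasure P (space P - A N) \<le> ennreal (r\<^sup>2)"
    using main[of N] by (meson le_add2 order_trans add_increasing order_refl zero_le)
  then have "\<pi> * measure P (space P - A N) \<le> \<delta> * \<pi>"
    using pi \<delta> by (simp add: emeasure_eq_measure ennreal_mult[symmetric] r2)
  then have "measure P (space P - A N) \<le> \<delta>" using pi by simp
  then have "1 - \<delta> \<le> measure P (A N)" using prob_compl[OF AP[of N]] by simp
  also have "\<dots> \<le> measure P {\<omega> \<in> space P. f (u N \<omega>) - fstar \<le> \<epsilon>}"
  proof (rule finite_measure_mono)
    show "A N \<subseteq> {\<omega> \<in> space P. f (u N \<omega>) - fstar \<le> \<epsilon>}"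
    proof safe
      fix \<omega> assume \<omega>: "\<omega> \<in> A N"
      then show "\<omega> \<in> space P" by (simp add: A_def)
      have "T N * (f (u N \<omega>) - fstar) \<le> \<pi>"
      proof -
        have "E N \<omega> \<le> \<pi>" using \<omega> by (simp add: A_def)
        then show ?thesis
          using zero_le_power2[of "norm (v N \<omega> - ustar)"]
          unfolding E_def potential_def by linarith
      qed
      also have "\<dots> \<le> T N * \<epsilon>" using TN \<epsilon> by (simp add: \<pi>_def field_simps)
      finally show "f (u N \<omega>) - fstar \<le> \<epsilon>" using T_pos[of N] by simp
    qed
    have "u N \<in> borel_measurable P" by (rule measurable_from_subalg[OF sub uv(1)]) simp
    then show "{\<omega> \<in> space P. f (u N \<omega>) - fstar \<le> \<epsilon>} \<in> sets P" by measurable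
  qed
  finally show ?thesis .
qed

end

theorem theorem4p2:
  fixes f :: "real^'m \<Rightarrow> real"
    and \<B> :: "'m set set"
    and \<kappa> \<nu> :: "'m set \<Rightarrow> real"
    and C0 C1 fstar \<Delta>bar r \<delta> \<epsilon> :: real
    and z ustar :: "real^'m"
    and P :: "'w measure"
    and Fil :: "nat \<Rightarrow> 'w measure"
    and u v :: "nat \<Rightarrow> 'w \<Rightarrow> real^'m"
    and Blk :: "nat \<Rightarrow> 'w \<Rightarrow> 'm set"
  assumes "convex_on UNIV f"
    and "C2_function f"
    and "\<forall>x. fstar \<le> f x" and "f ustar = fstar"
    and "partition_on UNIV \<B>"
    and "\<forall>B\<in>\<B>. \<kappa> B \<ge> 0 \<and> \<nu> B \<ge> 0"
    and "\<forall>x. \<forall>B\<in>\<B>. loewner_le 0 (block_hessian B f x) \<and>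
           loewner_le (block_hessian B f x) ((\<kappa> B + \<nu> B * (f x - fstar)) *\<^sub>R block_identity B)"
    and "C0 = (\<Sum>B\<in>\<B>. sqrt (\<kappa> B))" and "C1 = (\<Sum>B\<in>\<B>. sqrt (\<nu> B))"
    and "C0 > 0"
    and "\<Delta>bar \<ge> f z - fstar"
    and "r \<ge> norm (z - ustar)"
    and "0 < \<delta>" and "\<delta> < 1"
    and "0 < \<epsilon>" and "\<epsilon> < \<Delta>bar"
    and "prob_space P"
    and "accel_run P Fil f \<B> \<kappa> \<nu> z \<Delta>bar r \<delta> \<epsilon> u v Blk"
  shows "(\<exists>k. T_seq C0 C1 \<Delta>bar r \<delta> k \<ge> budget r \<delta> / \<epsilon>) \<and>
    measure P {\<omega> \<in> space P. f (u (stop_index C0 C1 \<Delta>bar r \<delta> \<epsilon>) \<omega>) - fstar \<le> \<epsilon>} \<ge> 1 - \<delta> \<and>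
    (\<exists>c>0. \<exists>q::nat. \<forall>c0 c1 D \<rho> d e :: real.
       c0 > 0 \<and> c1 \<ge> 0 \<and> \<rho> \<ge> 0 \<and> 0 < d \<and> d < 1 \<and> 0 < e \<and> e < D \<longrightarrow>
       real (stop_index c0 c1 D \<rho> d e)
         \<le> c * log_factor [\<rho>, c0, c1, D, d, e] ^ q
             * (1 + \<rho> * c0 / sqrt (d * e) + \<rho> * c1 / sqrt d))"
proof -
  note convex = assms(1) and C2 = assms(2) and lower = assms(3) and us = assms(4)
    and part = assms(5) and nonneg = assms(6) and curv = assms(7) and C0 = assms(8)
    and C1 = assms(9) and C0_pos = assms(10) and gap0 = assms(11) and radius = assms(12)
    and \<delta> = assms(13,14) and \<epsilon> = assms(15,16) and prob = assms(17) and run = assms(18)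
  interpret bs: block_smooth f fstar \<B> \<kappa> \<nu>
    using convex C2 lower part nonneg curv by unfold_locales auto
  have C0_eq: "C0 = bs.C0" and C1_eq: "C1 = bs.C1"
    using C0 C1 by (simp_all add: bs.C0_def bs.C1_def)
  have D: "0 < \<Delta>bar" using \<epsilon> by simp
  define N where "N = stop_index C0 C1 \<Delta>bar r \<delta> \<epsilon>"
  have "(\<exists>k. budget r \<delta> / \<epsilon> \<le> T_seq C0 C1 \<Delta>bar r \<delta> k) \<and>
      1 - \<delta> \<le> measure P {\<omega> \<in> space P. f (u N \<omega>) - fstar \<le> \<epsilon>}"
  proof (cases "r = 0")
    case True
    then have "z = ustar" using radius by simp
    moreover have "u 0 \<omega> = z" if "\<omega> \<in> space P" for \<omega>
      using run that by (simp add: accel_run_def Let_def)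
    moreover have "N = 0" using True by (simp add: N_def stop_index_radius_0)
    ultimately have "{\<omega> \<in> space P. f (u N \<omega>) - fstar \<le> \<epsilon>} = space P"
      using us \<epsilon> by auto
    moreover have "budget r \<delta> / \<epsilon> \<le> T_seq C0 C1 \<Delta>bar r \<delta> 0"
      using True by (simp add: budget_def)
    ultimately show ?thesis
      using prob_space.prob_space[OF prob] \<delta> by (auto intro: exI[of _ 0] simp del: T_seq.simps)
  next
    case False
    then have r: "0 < r" using radius norm_ge_zero[of "z - ustar"] by linarith
    interpret step_schedule C0 C1 \<Delta>bar r \<delta>
      using C0_pos C1_eq bs.C1_nonneg r D \<delta> by unfold_locales auto
    have ex: "\<exists>k. budget r \<delta> / \<epsilon> \<le> T_seq C0 C1 \<Delta>bar r \<delta> k"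
      by (rule schedule_finishes[OF \<delta>(2) \<epsilon>])
    then have "budget r \<delta> / \<epsilon> \<le> T_seq C0 C1 \<Delta>bar r \<delta> N"
      unfolding N_def stop_index_def by (rule LeastI_ex)
    then have "1 - \<delta> \<le> measure P {\<omega> \<in> space P. f (u N \<omega>) - fstar \<le> \<epsilon>}"
      using C0_pos by (intro bs.run_success_probability[OF prob run us _ r D \<delta> \<epsilon>(1) gap0 radius])
        (simp_all add: N_def C0_eq C1_eq)
    with ex show ?thesis by simp
  qed
  moreover have "\<exists>c>0. \<exists>q::nat. \<forall>c0 c1 D \<rho> d e :: real.
       c0 > 0 \<and> c1 \<ge> 0 \<and> \<rho> \<ge> 0 \<and> 0 < d \<and> d < 1 \<and> 0 < e \<and> e < D \<longrightarrow>
       real (stop_index c0 c1 D \<rho> d e)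
         \<le> c * log_factor [\<rho>, c0, c1, D, d, e] ^ q
             * (1 + \<rho> * c0 / sqrt (d * e) + \<rho> * c1 / sqrt d)"
  proof (rule exI[of _ 3], rule conjI, simp, rule exI[of _ 1], intro allI impI)
    fix c0 c1 D \<rho> d e :: real
    assume par: "c0 > 0 \<and> c1 \<ge> 0 \<and> \<rho> \<ge> 0 \<and> 0 < d \<and> d < 1 \<and> 0 < e \<and> e < D"
    show "real (stop_index c0 c1 D \<rho> d e)
         \<le> 3 * log_factor [\<rho>, c0, c1, D, d, e] ^ 1
             * (1 + \<rho> * c0 / sqrt (d * e) + \<rho> * c1 / sqrt d)"
    proof (cases "\<rho> = 0")
      case True
      have "0 \<le> log_factor [\<rho>, c0, c1, D, d, e]" by (simp add: log_factor_def)
      then show ?thesis using True by (simp add: stop_index_radius_0)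
    next
      case False
      then interpret step_schedule c0 c1 D \<rho> d
        using par by unfold_locales auto
      show ?thesis using stop_index_le[of e] par by simp
    qed
  qed
  ultimately show ?thesis by (simp add: N_def)
qed

end
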